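(* Consider the randomized version (with parameter $\epsilon\ge0$ and randomization $\omega$) of the problem $$\mathrm{minimize}_{\beta\in\mathbb{R}^p}\ \ell(\beta;S)+\|\beta\|,\qquad S\sim F,$$ that is, $\mathrm{minimize}_{\beta}\ \ell(\beta;S)+\|\beta\|-\omega^T\beta+\frac{\epsilon}{2}\|\beta\|_2^2$, where $\ell(\cdot;S)$ is $F$-almost surely a twice-differentiable convex function and $\|\beta\|=\sup_{z\in K}\beta^Tz$ is a seminorm. Let $\mathcal{F}$ be a smooth face of $K$, let $(\eta_i)_{i\in I}$ be an orthonormal (in the Euclidean metric) frame field normal to $\mathcal{F}$, and let $(V_j)_{j\in A}$ be an orthonormal (in the Euclidean metric) frame field tangent to $\mathcal{F}$. Let $$\psi(s,z,\gamma)=\nabla\ell(\beta(z,\gamma);s)+\epsilon\,\beta(z,\gamma)+z,\qquad \beta(z,\gamma)=\sum_{i\in I}\gamma_i\,\eta_{i,z},$$ restricted to $N(\mathcal{F})$, i.e. to $z\in\mathcal{F}$ and $\gamma\in\mathbb{R}^I$ with $\beta(z,\gamma)$ in the normal cone $N_zK$. Then, for $F$-almost every $s$, writing $\beta=\beta(z,\gamma)$, for all $i,l\in I$ and $j,k\in A$, $$\Big\langle\eta_i,\tfrac{\partial}{\partial\gamma_l}\psi\Big\rangle_{(s,\beta)}=\delta_{il},\qquad \Big\langle V_j,\tfrac{\partial}{\partial\gamma_i}\psi\Big\rangle_{(s,\beta)}=0,\qquad \langle V_j,V_k\psi\rangle_{(s,\beta)}=S_{-\beta}(V_j,V_k)+\langle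 V_j,V_k\rangle_{(s,\beta)},$$ and $$J\psi(s,z,\gamma)=\det(\nabla^2\ell(\beta;s)+\epsilon I)\cdot\det\big(G(s,z,\gamma)+C_{-\beta}(z,\gamma)\big)=\frac{\det\big(I+G(s,z,\gamma)^{-1}C_{-\beta}(z,\gamma)\big)}{\det(H(s,z,\gamma))},$$ where $$G(s,z,\gamma)_{jk}=\langle V_{j,z},V_{k,z}\rangle_{(s,\beta)},\qquad H(s,z,\gamma)_{il}=\langle P^\perp_{(s,\beta)}\eta_{i,z},P^\perp_{(s,\beta)}\eta_{l,z}\rangle_{(s,\beta)}.$$
   Context: **Setting.** $K\subset\mathbb{R}^p$ is a convex set with $0\in K$ whose support function $\beta\mapsto\sup_{z\in K}\beta^Tz$ is a seminorm. A smooth face $\mathcal{F}$ of $K$ means a subset of $K$ that is a smooth embedded submanifold of $\mathbb{R}^p$ (for example a smooth stratum of $K$; for the group LASSO, a product of spheres and open balls). $N_zK=\{v: v^T(x-z)\le 0\ \forall x\in K\}$ is the normal cone of $K$ at $z$. $\nabla,\nabla^2$ are the gradient and Hessian with respect to $\beta$. **Frames.** The frames may be local. At each $z$, $(V_{j,z})_{j\in A}$ is an orthonormal basis of $T_z\mathcal{F}$ and $(\eta_{i,z})_{i\in I}$ is an orthonormal basis of its Euclidean orthogonal complement, so $|A|=\dim\mathcal{F}$ and $|A|+|I|=p$; both depend smoothly on $z$. **Metric.** The Riemannian metric is $$\langle v,w\rangle_{(s,\beta)}=v^T(\nabla^2\ell(\beta;s)+\epsilon I)^{-1}w,$$ where $\nabla^2\ell(\beta;s)+\epsilon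 I$ is assumed positive definite (automatic if $\epsilon>0$). $P^\perp_{(s,\beta)}$ is the projection, orthogonal in this metric, onto the orthogonal complement of $T_z\mathcal{F}$. **Derivatives and Jacobian.** $V_k\psi$ denotes the directional derivative of $z\mapsto\psi(s,z,\gamma)$ along $V_{k,z}$ with $s$ and $\gamma$ held fixed (so the $\eta_{i,z}$ are differentiated as functions of $z$). $\frac{\partial}{\partial\gamma_i}\psi$ is the partial derivative of the formula for $\psi$ in $\gamma_i$. $J\psi(s,z,\gamma)$ is the absolute value of the determinant of the $p\times p$ matrix with columns $(V_j\psi)_{j\in A}$ and $(\frac{\partial}{\partial\gamma_i}\psi)_{i\in I}$. **Curvature.** For a vector $\eta$ normal to $\mathcal{F}$ at $z$, the shape operator of $\mathcal{F}$ in Euclidean $\mathbb{R}^p$ is $S_\eta(V,W)=\eta^T(D_VW)$, the second fundamental form paired with $\eta$, where $D$ is the Euclidean directional derivative and $W$ is extended to a tangent vector field on $\mathcal{F}$. $C_{-\beta}(z,\gamma)$ is the Euclidean curvature matrix with entries $C_{-\beta}(z,\gamma)_{jk}=S_{-\beta}(V_{j,z},V_{k,z})$. *)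

theory Defs
  imports "HOL-Probability.Probability"
begin

section \<open>Smooth maps and embedded submanifolds\<close>

text \<open>Intended for open \<^term>\<open>S\<close>, since the derivatives are taken in the whole space.\<close>

primrec Ck_on :: "nat \<Rightarrow> 'a::real_normed_vector set \<Rightarrow> ('a \<Rightarrow> 'b::real_normed_vector) \<Rightarrow> bool" where
  "Ck_on 0 S f \<longleftrightarrow> continuous_on S f"
| "Ck_on (Suc k) S f \<longleftrightarrow>
     (\<forall>x\<in>S. f differentiable (at x)) \<and> (\<forall>v. Ck_on k S (\<lambda>x. frechet_derivative f (at x) v))"

definition smooth_on :: "'a::real_normed_vector set \<Rightarrow> ('a \<Rightarrow> 'b::real_normed_vector) \<Rightarrow> bool" where
  "smooth_on S f \<longleftrightarrow> (\<forall>k. Ck_on k S f)"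

text \<open>Smoothness on an arbitrary subset, such as a relatively open piece of a submanifold:
  local existence of smooth extensions to open sets of the ambient space.\<close>

definition smooth_map_on :: "'a::real_normed_vector set \<Rightarrow> ('a \<Rightarrow> 'b::real_normed_vector) \<Rightarrow> bool" where
  "smooth_map_on W f \<longleftrightarrow>
     (\<forall>z\<in>W. \<exists>U g. open U \<and> z \<in> U \<and> smooth_on U g \<and> (\<forall>x\<in>U \<inter> W. g x = f x))"

definition smooth_submanifold :: "nat \<Rightarrow> 'a::euclidean_space set \<Rightarrow> bool" where
  "smooth_submanifold d M \<longleftrightarrow>
     (\<forall>z\<in>M. \<exists>(U::'a set) (V::'a set) \<phi> \<psi> L.
        open U \<and> z \<in> U \<and> open V \<and> homeomorphism U V \<phi> \<psi> \<and> smooth_on U \<phi> \<and> smooth_on V \<psi> \<and>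
        subspace L \<and> dim L = d \<and> \<phi> ` (U \<inter> M) = V \<inter> L)"

definition tangent_space :: "'a::euclidean_space set \<Rightarrow> 'a \<Rightarrow> 'a set" where
  "tangent_space M z =
     {v. \<exists>c e. (0::real) < e \<and> smooth_on {-e<..<e} c \<and> c ` {-e<..<e} \<subseteq> M \<and> c 0 = z \<and>
           (c has_vector_derivative v) (at 0)}"

text \<open>Directional derivative at \<^term>\<open>z\<close> of a map that matters only on the submanifold
  \<^term>\<open>M\<close>. A derivative within \<^term>\<open>M\<close> is in general not unique as a linear map on the ambient
  space, but any two of them agree on the tangent space, so this is used for tangent
  \<^term>\<open>v\<close> only.\<close>

definition deriv_along ::
    "'a::euclidean_space set \<Rightarrow> ('a \<Rightarrow> 'b::real_normed_vector) \<Rightarrow> 'a \<Rightarrow> 'a \<Rightarrow> 'b" where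
  "deriv_along M f z v = frechet_derivative f (at z within M) v"

text \<open>Shape operator paired with a normal vector \<^term>\<open>\<eta>\<close>: \<^term>\<open>v\<close> is a tangent
  vector at \<^term>\<open>z\<close> and \<^term>\<open>Y\<close> is a tangent vector field, i.e. an extension of the second
  argument \<^term>\<open>Y z\<close>, on which alone the value depends.\<close>

definition shape_op ::
    "'a::euclidean_space set \<Rightarrow> 'a \<Rightarrow> 'a \<Rightarrow> 'a \<Rightarrow> ('a \<Rightarrow> 'a) \<Rightarrow> real" where
  "shape_op M z \<eta> v Y = \<eta> \<bullet> deriv_along M Y z v"

definition orthonormal_basis_of ::
    "'i set \<Rightarrow> ('i \<Rightarrow> 'a::euclidean_space) \<Rightarrow> 'a set \<Rightarrow> bool" where
  "orthonormal_basis_of J b S \<longleftrightarrow>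
     (\<forall>i\<in>J. \<forall>j\<in>J. b i \<bullet> b j = (if i = j then 1 else 0)) \<and> span (b ` J) = S"


section \<open>Convex geometry\<close>

definition support_fun :: "'a::real_inner set \<Rightarrow> 'a \<Rightarrow> real" where
  "support_fun K \<beta> = (SUP z\<in>K. \<beta> \<bullet> z)"

definition is_seminorm :: "('a::real_vector \<Rightarrow> real) \<Rightarrow> bool" where
  "is_seminorm N \<longleftrightarrow>
     (\<forall>x y. N (x + y) \<le> N x + N y) \<and> (\<forall>c x. N (c *\<^sub>R x) = \<bar>c\<bar> * N x)"

definition normal_cone :: "'a::real_inner set \<Rightarrow> 'a \<Rightarrow> 'a set" where
  "normal_cone K z = {v. \<forall>x\<in>K. v \<bullet> (x - z) \<le> 0}"


section \<open>Gradient, Hessian, and the metric\<close>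

definition grad :: "('a::real_inner \<Rightarrow> real) \<Rightarrow> 'a \<Rightarrow> 'a" where
  "grad f x = (THE D. GDERIV f x :> D)"

definition twice_differentiable :: "('a::real_inner \<Rightarrow> real) \<Rightarrow> bool" where
  "twice_differentiable f \<longleftrightarrow>
     (\<forall>x. f differentiable (at x)) \<and> (\<forall>x. grad f differentiable (at x))"

definition hessian :: "(real^'p \<Rightarrow> real) \<Rightarrow> real^'p \<Rightarrow> real^'p^'p" where
  "hessian f x = jacobian (grad f) (at x)"

definition reg_hessian :: "(real^'p \<Rightarrow> real) \<Rightarrow> real \<Rightarrow> real^'p \<Rightarrow> real^'p^'p" where
  "reg_hessian f \<epsilon> x = hessian f x + \<epsilon> *\<^sub>R mat 1"

text \<open>Symmetry is not required here: it is automatic for the Hessian of a function that is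
  twice differentiable in the above sense.\<close>

definition pos_definite :: "real^'p^'p \<Rightarrow> bool" where
  "pos_definite Q \<longleftrightarrow> (\<forall>v. v \<noteq> 0 \<longrightarrow> 0 < v \<bullet> (Q *v v))"

definition riem :: "real^'p^'p \<Rightarrow> real^'p \<Rightarrow> real^'p \<Rightarrow> real" where
  "riem Q v w = v \<bullet> (matrix_inv Q *v w)"

definition form_complement :: "('a \<Rightarrow> 'a \<Rightarrow> real) \<Rightarrow> 'a set \<Rightarrow> 'a set" where
  "form_complement g T = {w. \<forall>t\<in>T. g w t = 0}"

definition form_projection :: "('a::real_vector \<Rightarrow> 'a \<Rightarrow> real) \<Rightarrow> 'a set \<Rightarrow> 'a \<Rightarrow> 'a" where
  "form_projection g N v = (THE w. w \<in> N \<and> (\<forall>u\<in>N. g (v - w) u = 0))"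


section \<open>Matrices indexed by a finite, possibly empty, set\<close>

text \<open>Either of the index sets of the tangent and the normal frame may be empty, which rules
  out matrices indexed by a type. The empty determinant is 1.\<close>

definition det_on :: "'i set \<Rightarrow> ('i \<Rightarrow> 'i \<Rightarrow> real) \<Rightarrow> real" where
  "det_on J M = (\<Sum>\<pi> | \<pi> permutes J. of_int (sign \<pi>) * (\<Prod>i\<in>J. M i (\<pi> i)))"

lemma det_on_UNIV: "det_on UNIV M = det (\<chi> i j. M i j)"
  by (simp add: det_on_def det_def)

lemma det_on_empty: "det_on {} M = 1"
  by (simp add: det_on_def)

definition inv_on :: "'i set \<Rightarrow> ('i \<Rightarrow> 'i \<Rightarrow> real) \<Rightarrow> 'i \<Rightarrow> 'i \<Rightarrow> real" where
  "inv_on J M = (THE N.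
     (\<forall>i j. i \<notin> J \<or> j \<notin> J \<longrightarrow> N i j = 0) \<and>
     (\<forall>i\<in>J. \<forall>k\<in>J. (\<Sum>j\<in>J. M i j * N j k) = (if i = k then 1 else 0)
                  \<and> (\<Sum>j\<in>J. N i j * M j k) = (if i = k then 1 else 0)))"


section \<open>The map whose Jacobian is computed\<close>

definition beta_of :: "'p set \<Rightarrow> ('p \<Rightarrow> real^'p \<Rightarrow> real^'p) \<Rightarrow> real^'p \<Rightarrow> ('p \<Rightarrow> real) \<Rightarrow> real^'p" where
  "beta_of I \<eta> z \<gamma> = (\<Sum>i\<in>I. \<gamma> i *\<^sub>R \<eta> i z)"

definition psi ::
    "(real^'p \<Rightarrow> real) \<Rightarrow> real \<Rightarrow> 'p set \<Rightarrow> ('p \<Rightarrow> real^'p \<Rightarrow> real^'p) \<Rightarrow> real^'p \<Rightarrow> ('p \<Rightarrow> real) \<Rightarrow> real^'p" where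
  "psi f \<epsilon> I \<eta> z \<gamma> = grad f (beta_of I \<eta> z \<gamma>) + \<epsilon> *\<^sub>R beta_of I \<eta> z \<gamma> + z"

end

theory Submission
  imports Defs
begin

text \<open>Write \<open>Q = \<nabla>\<^sup>2\<ell>(\<beta>) + \<epsilon> I\<close>. The chain rule gives \<open>\<partial>\<psi>/\<partial>\<gamma>\<^sub>i = Q \<eta>\<^sub>i\<close> and
  \<open>V\<^sub>k\<psi> = Q (D\<beta> V\<^sub>k) + V\<^sub>k\<close>, where \<open>D\<beta>\<close> differentiates the normal field \<open>z \<mapsto> \<beta>(z, \<gamma>)\<close>; pairing
  with \<open>Q\<^sup>-\<^sup>1\<close> turns \<open>V\<^sub>j \<bullet> D\<beta> V\<^sub>k\<close> into the curvature term, because \<open>\<beta>\<close> is normal. In the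
  orthonormal basis \<open>(V, \<eta>)\<close> the matrix of pairings \<open>\<langle>\<cdot>, \<psi>'\<rangle>\<close> is therefore block triangular with
  diagonal blocks \<open>G + C\<close> and \<open>I\<close>, which gives the determinant up to sign. The sign is positive
  since \<open>G\<close> is positive definite and \<open>C\<close> is positive semidefinite: \<open>\<beta>\<close> lies in the normal cone,
  so \<open>x \<mapsto> \<beta> \<bullet> x\<close> is maximal over the face at \<open>z\<close>. Finally \<open>det Q \<cdot> det G \<cdot> det H = 1\<close>, as
  \<open>G\<close> and \<open>H\<close> are the diagonal blocks of the Gram matrix of \<open>(V, P\<^sup>\<bottom>\<eta>)\<close>, a unipotent change of
  basis from \<open>(V, \<eta>)\<close>.\<close>

section \<open>Determinants over finite index sets\<close>

lemma det_on_cong: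
  assumes "\<And>i j. i \<in> J \<Longrightarrow> j \<in> J \<Longrightarrow> M i j = N i j"
  shows "det_on J M = det_on J N"
  unfolding det_on_def
  by (intro sum.cong refl arg_cong2[where f="(*)"] prod.cong) (auto simp: assms permutes_in_image)

lemma det_on_identity:
  assumes "finite J"
  shows "det_on J (\<lambda>i j. if i = j then 1 else 0) = 1"
proof -
  have "(\<Prod>i\<in>J. if i = \<pi> i then 1 else (0::real)) = 0"
    if p: "\<pi> permutes J" and nid: "\<pi> \<noteq> id" for \<pi>
  proof -
    obtain i where i: "\<pi> i \<noteq> i" using nid by fastforce
    with p have "i \<in> J" by (metis permutes_not_in)
    with i show ?thesis using assms by (intro prod_zero) force+
  qed
  then have "det_on J (\<lambda>i j. if i = j then 1 else 0) =
      (\<Sum>\<pi>\<in>{id}. of_int (sign \<pi>) * (\<Prod>i\<in>J. if i = \<pi> i then 1 else (0::real)))"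
    unfolding det_on_def
    by (intro sum.mono_neutral_right) (auto simp: assms finite_permutations)
  then show ?thesis by simp
qed

text \<open>In the Leibniz sum a permutation sending some index of \<open>A\<close> into
  \<open>I\<close> picks up a zero entry. Every other one preserves both sets and splits uniquely
  into a permutation of \<open>A\<close> and one of \<open>I\<close>, so the sum factors.\<close>

lemma det_block_triangular:
  fixes A I :: "'p::finite set" and M :: "'p \<Rightarrow> 'p \<Rightarrow> real"
  assumes disj: "A \<inter> I = {}" and un: "A \<union> I = UNIV"
    and zero: "\<And>i j. i \<in> A \<Longrightarrow> j \<in> I \<Longrightarrow> M i j = 0"
  shows "det (\<chi> i j. M i j) = det_on A M * det_on I M"
proof -
  define t where "t \<pi> = of_int (sign \<pi>) * (\<Prod>i\<in>UNIV. M i (\<pi> i))" for \<pi>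
  let ?PA = "{p. p permutes A}" and ?PI = "{q. q permutes I}"
  let ?c = "\<lambda>(p, q). p \<circ> q :: 'p \<Rightarrow> 'p"
  have notA: "i \<notin> A \<longleftrightarrow> i \<in> I" for i using disj un by blast
  have onA: "(p \<circ> q) i = p i" if "q permutes I" "i \<in> A" for p q i
    using that notA by (metis comp_apply permutes_not_in)
  have onI: "(p \<circ> q) i = q i" if "p permutes A" "q permutes I" "i \<in> I" for p q i
    using that notA by (metis comp_apply permutes_not_in permutes_in_image)
  have inj: "inj_on ?c (?PA \<times> ?PI)"
  proof (rule inj_onI, clarify)
    fix p q p' q'
    assume h: "p permutes A" "q permutes I" "p' permutes A" "q' permutes I" "p \<circ> q = p' \<circ> q'"
    have "p i = p' i \<and> q i = q' i" for i
    proof (cases "i \<in> A")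
      case True
      then show ?thesis using h onA[of q i p] onA[of q' i p'] notA by (metis permutes_not_in)
    next
      case False
      then show ?thesis using h onI[of p q i] onI[of p' q' i] notA by (metis permutes_not_in)
    qed
    then show "p = p' \<and> q = q'" by auto
  qed
  have sub: "?c ` (?PA \<times> ?PI) \<subseteq> {\<pi>. \<pi> permutes UNIV}"
    by (auto intro!: permutes_compose intro: permutes_subset)
  \<comment> \<open>If nothing in \<open>A\<close> went to \<open>I\<close>, injectivity on the
    finite set \<open>A\<close> would make \<open>\<pi>\<close> a bijection of \<open>A\<close>,
    hence of its complement \<open>I\<close>. The two restrictions, extended by the identity, would
    then exhibit \<open>\<pi>\<close> as a composition in the image.\<close>
  have out: "t \<pi> = 0" if \<pi>: "\<pi> permutes UNIV" and nin: "\<pi> \<notin> ?c ` (?PA \<times> ?PI)" for \<pi>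
  proof -
    have "\<exists>i\<in>A. \<pi> i \<in> I"
    proof (rule ccontr)
      assume "\<not> ?thesis"
      then have AA: "\<pi> ` A \<subseteq> A" using notA by blast
      have injp: "inj \<pi>" using \<pi> by (rule permutes_inj)
      have A_eq: "\<pi> ` A = A"
        by (rule endo_inj_surj) (use AA injp in \<open>auto intro: inj_on_subset\<close>)
      have I_eq: "\<pi> ` I = I"
      proof -
        have "I = - A" using notA by blast
        then show ?thesis using A_eq \<pi> by (metis bij_image_Compl_eq permutes_bij)
      qed
      define p where "p i = (if i \<in> A then \<pi> i else i)" for i
      define q where "q i = (if i \<in> I then \<pi> i else i)" for i
      have "p permutes A"
        by (rule bij_imp_permutes)
          (use A_eq injp in \<open>auto simp: p_def bij_betw_def inj_on_def\<close>)
      moreover have "q permutes I"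
        by (rule bij_imp_permutes)
          (use I_eq injp in \<open>auto simp: q_def bij_betw_def inj_on_def\<close>)
      moreover have "\<pi> = p \<circ> q"
        using A_eq I_eq notA by (auto simp: p_def q_def fun_eq_iff)
      ultimately show False using nin by auto
    qed
    then obtain i where "i \<in> A" "\<pi> i \<in> I" by blast
    then have "M i (\<pi> i) = 0" by (rule zero)
    then show ?thesis unfolding t_def using prod_zero[of UNIV "\<lambda>i. M i (\<pi> i)"] by auto
  qed
  have split: "t (p \<circ> q) =
      (of_int (sign p) * (\<Prod>i\<in>A. M i (p i))) * (of_int (sign q) * (\<Prod>i\<in>I. M i (q i)))"
    if p: "p permutes A" and q: "q permutes I" for p q
  proof -
    have "(\<Prod>i\<in>UNIV. M i ((p \<circ> q) i)) = (\<Prod>i\<in>A. M i ((p \<circ> q) i)) * (\<Prod>i\<in>I. M i ((p \<circ> q) i))"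
      using disj un by (metis finite prod.union_disjoint)
    also have "\<dots> = (\<Prod>i\<in>A. M i (p i)) * (\<Prod>i\<in>I. M i (q i))"
      by (intro arg_cong2[where f="(*)"] prod.cong refl) (simp_all only: onA[OF q] onI[OF p q])
    moreover have "sign (p \<circ> q) = sign p * sign q"
      by (intro sign_compose permutes_imp_permutation[OF finite p]
          permutes_imp_permutation[OF finite q])
    ultimately show ?thesis unfolding t_def by (simp add: algebra_simps)
  qed
  have "det (\<chi> i j. M i j) = (\<Sum>\<pi> | \<pi> permutes UNIV. t \<pi>)"
    by (simp add: det_def t_def)
  also have "\<dots> = (\<Sum>\<pi>\<in>?c ` (?PA \<times> ?PI). t \<pi>)"
    by (rule sum.mono_neutral_right) (use sub out in \<open>auto simp: finite_permutations\<close>)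
  also have "\<dots> = (\<Sum>(p, q)\<in>?PA \<times> ?PI. t (p \<circ> q))"
    by (subst sum.reindex[OF inj]) (simp add: case_prod_unfold comp_def)
  also have "\<dots> = (\<Sum>p\<in>?PA. \<Sum>q\<in>?PI. t (p \<circ> q))"
    by (simp add: sum.cartesian_product)
  also have "\<dots> = det_on A M * det_on I M"
    unfolding det_on_def sum_product by (intro sum.cong refl) (use split in simp)
  finally show ?thesis .
qed

section \<open>Reduction to full square matrices by padding with the identity\<close>

text \<open>An identity block outside \<open>J\<close> embeds the matrices over \<open>J\<close>,
  including the case of empty \<open>J\<close>, multiplicatively into the square matrices over the
  whole type, where \<open>det\<close> and \<open>invertible\<close> are available.\<close>

definition pad :: "'p set \<Rightarrow> ('p \<Rightarrow> 'p \<Rightarrow> real) \<Rightarrow> real^'p^'p" where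
  "pad J M = (\<chi> i j. if i \<in> J \<and> j \<in> J then M i j else if i = j then 1 else 0)"

lemma pad_nth: "pad J M $ i $ j = (if i \<in> J \<and> j \<in> J then M i j else if i = j then 1 else 0)"
  by (simp add: pad_def)

text \<open>The off-diagonal blocks vanish and the block on \<open>- J\<close> is the identity,
  contributing the factor 1.\<close>

lemma det_pad: "det (pad J M) = det_on J M"
proof -
  let ?N = "\<lambda>i j. if i \<in> J \<and> j \<in> J then M i j else if i = j then 1 else 0"
  have "det (pad J M) = det_on J ?N * det_on (- J) ?N"
    unfolding pad_def by (rule det_block_triangular) auto
  moreover have "det_on J ?N = det_on J M" by (rule det_on_cong) simp
  moreover have "det_on (- J) ?N = det_on (- J) (\<lambda>i j. if i = j then 1 else 0)"
    by (rule det_on_cong) simp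
  ultimately show ?thesis by (simp add: det_on_identity)
qed

lemma sum_pad:
  fixes J :: "'p::finite set"
  assumes "i \<in> J"
  shows "(\<Sum>k\<in>UNIV. pad J M $ i $ k * f k) = (\<Sum>k\<in>J. M i k * f k)"
    and "(\<Sum>k\<in>UNIV. f k * pad J M $ k $ i) = (\<Sum>k\<in>J. f k * M k i)"
proof -
  have "(\<Sum>k\<in>UNIV. pad J M $ i $ k * f k) = (\<Sum>k\<in>J. pad J M $ i $ k * f k)"
    by (rule sum.mono_neutral_right) (use assms in \<open>auto simp: pad_nth\<close>)
  then show "(\<Sum>k\<in>UNIV. pad J M $ i $ k * f k) = (\<Sum>k\<in>J. M i k * f k)"
    using assms by (simp add: pad_nth)
  have "(\<Sum>k\<in>UNIV. f k * pad J M $ k $ i) = (\<Sum>k\<in>J. f k * pad J M $ k $ i)"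
    by (rule sum.mono_neutral_right) (use assms in \<open>auto simp: pad_nth\<close>)
  then show "(\<Sum>k\<in>UNIV. f k * pad J M $ k $ i) = (\<Sum>k\<in>J. f k * M k i)"
    using assms by (simp add: pad_nth)
qed

lemma pad_mult: "pad J M ** pad J N = pad J (\<lambda>i k. \<Sum>j\<in>J. M i j * N j k)"
proof -
  have "(pad J M ** pad J N) $ i $ k = pad J (\<lambda>i k. \<Sum>j\<in>J. M i j * N j k) $ i $ k" for i k
  proof (cases "i \<in> J")
    case True
    have "(pad J M ** pad J N) $ i $ k = (\<Sum>j\<in>J. M i j * pad J N $ j $ k)"
      by (simp add: matrix_matrix_mult_def sum_pad(1)[OF True])
    also have "\<dots> = (\<Sum>j\<in>J. if k \<in> J then M i j * N j k else 0)"
      by (rule sum.cong) (auto simp: pad_nth)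
    finally show ?thesis using True by (auto simp: pad_nth)
  next
    case False
    have "(pad J M ** pad J N) $ i $ k = (\<Sum>j\<in>UNIV. if j = i then pad J N $ i $ k else 0)"
      unfolding matrix_matrix_mult_def vec_lambda_beta
      by (rule sum.cong) (use False in \<open>auto simp: pad_nth\<close>)
    then show ?thesis using False by (simp add: pad_nth)
  qed
  then show ?thesis by (simp add: vec_eq_iff)
qed

lemma det_on_mult:
  fixes J :: "'p::finite set"
  shows "det_on J M * det_on J N = det_on J (\<lambda>i k. \<Sum>j\<in>J. M i j * N j k)"
  by (simp flip: det_pad pad_mult add: det_mul)

text \<open>Since \<open>inv_on\<close> is a definite description, existence and uniqueness both
  have to be shown. Existence cuts the inverse of the padded matrix down to \<open>J\<close>; for
  uniqueness, two-sided inverses agree on \<open>J\<close>, and the entries elsewhere are prescribed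
  to be zero.\<close>

lemma inv_on_right:
  fixes J :: "'p::finite set"
  assumes "det_on J M \<noteq> 0" and "i \<in> J" and "k \<in> J"
  shows "(\<Sum>j\<in>J. M i j * inv_on J M j k) = (if i = k then 1 else 0)"
proof -
  let ?P = "\<lambda>N. (\<forall>i j. i \<notin> J \<or> j \<notin> J \<longrightarrow> N i j = 0) \<and>
     (\<forall>i\<in>J. \<forall>k\<in>J. (\<Sum>j\<in>J. M i j * N j k) = (if i = k then 1 else 0)
                  \<and> (\<Sum>j\<in>J. N i j * M j k) = (if i = k then 1 else 0))"
  have "invertible (pad J M)"
    using assms(1) by (simp add: invertible_det_nz det_pad)
  then obtain X where X: "pad J M ** X = mat 1" "X ** pad J M = mat 1"
    by (auto simp: invertible_def)
  define N where "N i j = (if i \<in> J \<and> j \<in> J then X $ i $ j else 0)" for i j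
  have "?P N"
  proof (intro conjI allI impI ballI)
    fix i k assume ik: "i \<in> J" "k \<in> J"
    have "(pad J M ** X) $ i $ k = (\<Sum>j\<in>J. M i j * X $ j $ k)"
      by (simp add: matrix_matrix_mult_def sum_pad(1)[OF ik(1)])
    then show "(\<Sum>j\<in>J. M i j * N j k) = (if i = k then 1 else 0)"
      using ik by (simp add: X mat_def N_def)
    have "(X ** pad J M) $ i $ k = (\<Sum>j\<in>J. X $ i $ j * M j k)"
      by (simp add: matrix_matrix_mult_def sum_pad(2)[OF ik(2)])
    then show "(\<Sum>j\<in>J. N i j * M j k) = (if i = k then 1 else 0)"
      using ik by (simp add: X mat_def N_def)
  qed (auto simp: N_def)
  moreover have "N' = N" if N': "?P N'" for N'
  proof (intro ext)
    fix i k
    show "N' i k = N i k"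
    proof (cases "i \<in> J \<and> k \<in> J")
      case True
      \<comment> \<open>The chain N' = N' (M N) = (N' M) N = N, entry by entry.\<close>
      have "N' i k = (\<Sum>j\<in>J. N' i j * (\<Sum>l\<in>J. M j l * N l k))"
      proof -
        have "(\<Sum>j\<in>J. N' i j * (\<Sum>l\<in>J. M j l * N l k)) = (\<Sum>j\<in>J. if j = k then N' i j else 0)"
          by (rule sum.cong) (use \<open>?P N\<close> True in auto)
        then show ?thesis using True by simp
      qed
      also have "\<dots> = (\<Sum>l\<in>J. (\<Sum>j\<in>J. N' i j * M j l) * N l k)"
        by (simp add: sum_distrib_left sum_distrib_right mult.assoc) (rule sum.swap)
      also have "\<dots> = (\<Sum>l\<in>J. if l = i then N l k else 0)"
        by (rule sum.cong) (use N' True in auto)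
      also have "\<dots> = N i k" using True by simp
      finally show ?thesis .
    qed (use \<open>?P N\<close> N' in auto)
  qed
  ultimately have "?P (inv_on J M)"
    unfolding inv_on_def by (rule theI)
  then show ?thesis using assms by blast
qed

section \<open>Positive determinants from positive quadratic forms\<close>

text \<open>The segment from the identity to \<open>Q\<close> consists of matrices with positive
  quadratic form, hence with trivial kernel. The determinant starts at 1 and never vanishes there,
  so it ends positive. This argument covers nonsymmetric matrices.\<close>

lemma pos_definite_det_pos:
  fixes Q :: "real^'p^'p"
  assumes "pos_definite Q"
  shows "0 < det Q"
proof (rule ccontr)
  assume neg: "\<not> 0 < det Q"
  define f where "f t = det ((1 - t) *\<^sub>R mat 1 + t *\<^sub>R Q)" for t :: real
  have "continuous_on {0..1} f"
    unfolding f_def det_def by (auto intro!: continuous_intros)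
  moreover have "f 0 = 1" "f 1 \<le> 0" using neg by (simp_all add: f_def)
  ultimately obtain t where t: "0 \<le> t" "t \<le> 1" "f t = 0"
    using IVT2'[of f 1 0 0] by auto
  let ?M = "(1 - t) *\<^sub>R mat 1 + t *\<^sub>R Q"
  have "\<not> invertible ?M" using t(3) by (simp add: f_def invertible_det_nz)
  then obtain x where x: "x \<noteq> 0" "?M *v x = 0"
    unfolding invertible_left_inverse matrix_left_invertible_ker by blast
  have "?M *v x = (1 - t) *\<^sub>R x + t *\<^sub>R (Q *v x)"
    by (simp add: matrix_vector_mult_add_rdistrib flip: scaleR_matrix_vector_assoc)
  with x(2) have "(1 - t) * (x \<bullet> x) + t * (x \<bullet> (Q *v x)) = 0"
    by (metis inner_add_right inner_scaleR_right inner_zero_right)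
  moreover have "0 < x \<bullet> x" "0 < x \<bullet> (Q *v x)"
    using x(1) assms by (auto simp: pos_definite_def)
  ultimately show False using t(1,2)
    by (smt (verit) mult_nonneg_nonneg mult_pos_pos)
qed

text \<open>The padded matrix is positive definite: its quadratic form is that of \<open>M\<close>
  in the coordinates from \<open>J\<close> plus the sum of squares of the remaining
  coordinates.\<close>

lemma det_on_pos:
  fixes J :: "'p::finite set"
  assumes "\<And>a. (\<exists>j\<in>J. a j \<noteq> 0) \<Longrightarrow> 0 < (\<Sum>j\<in>J. \<Sum>k\<in>J. a j * M j k * a k)"
  shows "0 < det_on J M"
proof -
  have "pos_definite (pad J M)"
    unfolding pos_definite_def
  proof (intro allI impI)
    fix v :: "real^'p" assume "v \<noteq> 0"
    have "v \<bullet> (pad J M *v v) = (\<Sum>j\<in>UNIV. v $ j * (\<Sum>k\<in>UNIV. pad J M $ j $ k * v $ k))"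
      by (simp add: inner_vec_def matrix_vector_mult_def)
    also have "\<dots> = (\<Sum>j\<in>J. v $ j * (\<Sum>k\<in>UNIV. pad J M $ j $ k * v $ k)) +
        (\<Sum>j\<in>-J. v $ j * (\<Sum>k\<in>UNIV. pad J M $ j $ k * v $ k))"
      by (subst sum.union_disjoint[symmetric]) auto
    also have "(\<Sum>j\<in>J. v $ j * (\<Sum>k\<in>UNIV. pad J M $ j $ k * v $ k)) =
        (\<Sum>j\<in>J. \<Sum>k\<in>J. v $ j * M j k * v $ k)"
      by (simp add: sum_pad(1) sum_distrib_left mult.assoc)
    also have "(\<Sum>j\<in>-J. v $ j * (\<Sum>k\<in>UNIV. pad J M $ j $ k * v $ k)) = (\<Sum>j\<in>-J. (v $ j)\<^sup>2)"
    proof (rule sum.cong)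
      fix j assume "j \<in> - J"
      then have "(\<Sum>k\<in>UNIV. pad J M $ j $ k * v $ k) = (\<Sum>k\<in>UNIV. if k = j then v $ j else 0)"
        by (intro sum.cong) (auto simp: pad_nth)
      then show "v $ j * (\<Sum>k\<in>UNIV. pad J M $ j $ k * v $ k) = (v $ j)\<^sup>2"
        by (simp add: power2_eq_square)
    qed simp
    finally have eq: "v \<bullet> (pad J M *v v) =
        (\<Sum>j\<in>J. \<Sum>k\<in>J. v $ j * M j k * v $ k) + (\<Sum>j\<in>-J. (v $ j)\<^sup>2)" .
    show "0 < v \<bullet> (pad J M *v v)"
    proof (cases "\<exists>j\<in>J. v $ j \<noteq> 0")
      case True
      moreover have "0 \<le> (\<Sum>j\<in>-J. (v $ j)\<^sup>2)" by (simp add: sum_nonneg)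
      ultimately show ?thesis using assms[of "\<lambda>j. v $ j"] eq by simp
    next
      case False
      then obtain j where "j \<in> -J" "v $ j \<noteq> 0" using \<open>v \<noteq> 0\<close> by (metis ComplI vec_eq_iff zero_index)
      then have "0 < (\<Sum>j\<in>-J. (v $ j)\<^sup>2)" by (intro sum_pos2[where i=j]) auto
      with False show ?thesis by (simp add: eq)
    qed
  qed
  then show ?thesis using pos_definite_det_pos by (metis det_pad)
qed

section \<open>Derivatives along submanifolds\<close>

text \<open>The mean value theorem in direction \<open>a\<close>, applied to the difference of
  \<open>f\<close> on two parallel segments offset by \<open>t b\<close>, produces an increment of
  the derivative along \<open>a\<close>; differentiability of the latter at \<open>x\<close>
  evaluates it as \<open>t * D b + o(t)\<close>. The quotient is symmetric in \<open>a\<close> and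
  \<open>b\<close>, which is what Schwarz's theorem exploits.\<close>

lemma second_difference_tendsto:
  fixes f :: "'a::real_normed_vector \<Rightarrow> real"
  assumes "open S" and "x \<in> S"
    and f: "\<And>y. y \<in> S \<Longrightarrow> (f has_derivative f' y) (at y)"
    and D: "((\<lambda>y. f' y a) has_derivative D) (at x)"
  shows "((\<lambda>t. (f (x + t *\<^sub>R a + t *\<^sub>R b) - f (x + t *\<^sub>R a) - f (x + t *\<^sub>R b) + f x) / t\<^sup>2)
           \<longlongrightarrow> D b) (at_right 0)"
proof (rule tendstoI)
  fix e :: real assume "e > 0"
  define N where "N = norm a + norm b + 1"
  have N: "N > 0" "norm a + norm b < N" by (simp_all add: N_def add_nonneg_pos)
  \<comment> \<open>Two errors of size \<open>e' * (t * N)\<close> arise below, together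
    \<open>t * e / 2\<close>, strictly below the allowed \<open>t * e\<close>.\<close>
  define e' where "e' = e / (4 * N)"
  have e': "e' > 0" using \<open>e > 0\<close> N by (simp add: e'_def)
  interpret D: bounded_linear D using D by (rule has_derivative_bounded_linear)
  obtain d1 where d1: "d1 > 0"
      "\<And>h. norm h < d1 \<Longrightarrow> \<bar>f' (x + h) a - f' x a - D h\<bar> \<le> e' * norm h"
    using D e' unfolding has_derivative_at_alt
    by (metis add_diff_cancel_left' real_norm_def)
  obtain d2 where d2: "d2 > 0" "ball x d2 \<subseteq> S"
    using assms(1,2) open_contains_ball by blast
  define d where "d = min d1 d2 / N"
  have "d > 0" using d1 d2 N by (simp add: d_def)
  have main: "dist ((f (x + t *\<^sub>R a + t *\<^sub>R b) - f (x + t *\<^sub>R a) - f (x + t *\<^sub>R b) + f x) / t\<^sup>2) (D b) < e"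
    if t: "0 < t" "t < d" for t
  proof -
    have tN: "t * N < min d1 d2" using t N by (simp add: d_def pos_less_divide_eq)
    have small: "norm (s *\<^sub>R a + r *\<^sub>R b) < min d1 d2" "norm (s *\<^sub>R a + r *\<^sub>R b) \<le> t * N"
      if sr: "0 \<le> s" "s \<le> t" "0 \<le> r" "r \<le> t" for s r
    proof -
      have "norm (s *\<^sub>R a + r *\<^sub>R b) \<le> s * norm a + r * norm b"
        using sr by (metis abs_of_nonneg norm_scaleR norm_triangle_ineq)
      also have "\<dots> \<le> t * norm a + t * norm b"
        using sr by (intro add_mono mult_right_mono) auto
      also have "\<dots> \<le> t * N" using t N by (simp flip: distrib_left)
      finally show "norm (s *\<^sub>R a + r *\<^sub>R b) \<le> t * N" .
      with tN show "norm (s *\<^sub>R a + r *\<^sub>R b) < min d1 d2" by simp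
    qed
    \<comment> \<open>The term \<open>0 *\<^sub>R b\<close> is kept so that both segments have the
      shape \<open>s a + r b\<close>, with \<open>r = t\<close> and \<open>r = 0\<close>, and
      \<open>line\<close> covers both.\<close>
    define g where "g s = f (x + (s *\<^sub>R a + t *\<^sub>R b)) - f (x + (s *\<^sub>R a + 0 *\<^sub>R b))" for s
    define g' where "g' s = f' (x + (s *\<^sub>R a + t *\<^sub>R b)) a - f' (x + (s *\<^sub>R a + 0 *\<^sub>R b)) a" for s
    have inS: "x + (s *\<^sub>R a + r *\<^sub>R b) \<in> S" if "0 \<le> s" "s \<le> t" "0 \<le> r" "r \<le> t" for s r
    proof -
      have "x + (s *\<^sub>R a + r *\<^sub>R b) \<in> ball x d2"
        unfolding mem_ball dist_norm using small(1)[OF that]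
        by (metis add_diff_cancel_left' min_less_iff_conj norm_minus_commute)
      then show ?thesis using d2(2) by blast
    qed
    have line: "((\<lambda>s. f (x + (s *\<^sub>R a + r *\<^sub>R b))) has_real_derivative f' (x + (s *\<^sub>R a + r *\<^sub>R b)) a) (at s)"
      if "0 \<le> s" "s \<le> t" "0 \<le> r" "r \<le> t" for s r
    proof -
      have F: "(f has_derivative f' (x + (s *\<^sub>R a + r *\<^sub>R b))) (at (x + (s *\<^sub>R a + r *\<^sub>R b)))"
        by (rule f) (rule inS[OF that])
      have "((\<lambda>s. x + (s *\<^sub>R a + r *\<^sub>R b)) has_derivative (\<lambda>h. h *\<^sub>R a)) (at s)"
        by (auto intro!: derivative_eq_intros)
      from has_derivative_compose[OF this F] linear_cmul[OF has_derivative_linear[OF F]]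
      show ?thesis by (simp add: has_field_derivative_def mult_commute_abs)
    qed
    have "\<And>s. 0 \<le> s \<Longrightarrow> s \<le> t \<Longrightarrow> (g has_real_derivative g' s) (at s)"
      unfolding g_def g'_def by (intro DERIV_diff line) (use t in auto)
    then obtain \<xi> where \<xi>: "0 < \<xi>" "\<xi> < t" "g t - g 0 = (t - 0) * g' \<xi>"
      using MVT2[of 0 t g g'] t by blast
    have "\<bar>f' (x + (\<xi> *\<^sub>R a + r *\<^sub>R b)) a - f' x a - D (\<xi> *\<^sub>R a + r *\<^sub>R b)\<bar> \<le> e' * (t * N)"
      if "0 \<le> r" "r \<le> t" for r
    proof -
      have "norm (\<xi> *\<^sub>R a + r *\<^sub>R b) < d1" "norm (\<xi> *\<^sub>R a + r *\<^sub>R b) \<le> t * N"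
        using small[of \<xi> r] \<xi> that by auto
      then show ?thesis using d1(2)[of "\<xi> *\<^sub>R a + r *\<^sub>R b"] e'
        by (meson mult_left_mono less_imp_le order_trans)
    qed
    \<comment> \<open>Subtracting the estimates for \<open>r = t\<close> and \<open>r = 0\<close>
      cancels \<open>f' x a\<close> and, by linearity of \<open>D\<close>, leaves
      \<open>t * D b\<close>.\<close>
    from this[of t] this[of 0] t
    have "\<bar>g' \<xi> - t * D b\<bar> \<le> 2 * (e' * (t * N))"
      by (simp add: g'_def D.add D.scaleR)
    also have "\<dots> < t * e" using \<open>e > 0\<close> N t by (simp add: e'_def)
    finally have "\<bar>g' \<xi> - t * D b\<bar> < t * e" .
    then have "\<bar>g' \<xi> / t - D b\<bar> < e"
      using t by (simp add: abs_less_iff field_simps)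
    moreover have "(f (x + t *\<^sub>R a + t *\<^sub>R b) - f (x + t *\<^sub>R a) - f (x + t *\<^sub>R b) + f x) = t * g' \<xi>"
      using \<xi>(3) by (simp add: g_def algebra_simps)
    ultimately show ?thesis using t by (simp add: dist_real_def power2_eq_square)
  qed
  show "\<forall>\<^sub>F t in at_right 0. dist ((f (x + t *\<^sub>R a + t *\<^sub>R b) - f (x + t *\<^sub>R a) - f (x + t *\<^sub>R b) + f x) / t\<^sup>2) (D b) < e"
    unfolding eventually_at_right_field using main \<open>d > 0\<close> by auto
qed

text \<open>Schwarz's theorem: exchanging \<open>a\<close> and \<open>b\<close> leaves the second
  difference quotient unchanged, so the two limits coincide. The directional derivatives are
  differentiated at the single point \<open>x\<close>, which fits a loss that is merely twice
  differentiable.\<close>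

lemma second_derivative_symmetric:
  fixes f :: "'a::real_normed_vector \<Rightarrow> real"
  assumes "open S" and "x \<in> S"
    and "\<And>y. y \<in> S \<Longrightarrow> (f has_derivative f' y) (at y)"
    and "((\<lambda>y. f' y a) has_derivative Da) (at x)"
    and "((\<lambda>y. f' y b) has_derivative Db) (at x)"
  shows "Da b = Db a"
proof (rule tendsto_unique)
  let ?d = "\<lambda>t. (f (x + t *\<^sub>R a + t *\<^sub>R b) - f (x + t *\<^sub>R a) - f (x + t *\<^sub>R b) + f x) / t\<^sup>2"
  show "at_right (0::real) \<noteq> bot" by (simp add: trivial_limit_at_right_real)
  show "(?d \<longlongrightarrow> Da b) (at_right 0)"
    by (rule second_difference_tendsto[OF assms(1-4)])
  have "(\<lambda>t. (f (x + t *\<^sub>R b + t *\<^sub>R a) - f (x + t *\<^sub>R b) - f (x + t *\<^sub>R a) + f x) / t\<^sup>2) = ?d"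
    by (simp add: fun_eq_iff algebra_simps)
  then show "(?d \<longlongrightarrow> Db a) (at_right 0)"
    using second_difference_tendsto[OF assms(1-3,5), of a] by simp
qed

section \<open>Gradient and Hessian\<close>

text \<open>The Riesz representative \<open>adjoint f' 1\<close> of the derivative is the only
  vector meeting the description that defines \<open>grad\<close>.\<close>

lemma grad_has_derivative:
  fixes f :: "'a::euclidean_space \<Rightarrow> real"
  assumes "f differentiable (at x)"
  shows "(f has_derivative (\<lambda>h. h \<bullet> grad f x)) (at x)"
proof -
  obtain f' where f': "(f has_derivative f') (at x)"
    using assms by (auto simp: differentiable_def)
  have "f' = (\<lambda>h. h \<bullet> adjoint f' 1)"
    using adjoint_works[OF has_derivative_linear[OF f']] by (auto simp: fun_eq_iff)
  with f' have g: "GDERIV f x :> adjoint f' 1" by (simp add: gderiv_def)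
  moreover have "D = adjoint f' 1" if "GDERIV f x :> D" for D
  proof -
    have "(\<lambda>h. h \<bullet> D) = (\<lambda>h. h \<bullet> adjoint f' 1)"
      using that g unfolding gderiv_def by (rule has_derivative_unique)
    then show ?thesis by (metis vector_eq_ldot)
  qed
  ultimately have "GDERIV f x :> grad f x"
    unfolding grad_def by (rule theI)
  then show ?thesis by (simp add: gderiv_def)
qed

lemma grad_has_derivative_hessian:
  assumes "twice_differentiable f"
  shows "(grad f has_derivative (\<lambda>v. hessian f x *v v)) (at x)"
proof -
  have "grad f differentiable (at x)"
    using assms by (simp add: twice_differentiable_def)
  then show ?thesis by (simp add: hessian_def jacobian_works)
qed

text \<open>Schwarz's theorem for the directional derivatives \<open>v \<bullet> grad f y\<close>.
  The symmetry of the metric rests on it, as \<open>pos_definite\<close> does not include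
  symmetry.\<close>

lemma hessian_symmetric:
  fixes f :: "real^'p \<Rightarrow> real"
  assumes "twice_differentiable f"
  shows "v \<bullet> (hessian f x *v w) = w \<bullet> (hessian f x *v v)"
proof (rule second_derivative_symmetric[where S = UNIV and x = x and f = f and f' = "\<lambda>y h. h \<bullet> grad f y"
      and Da = "\<lambda>h. v \<bullet> (hessian f x *v h)" and Db = "\<lambda>h. w \<bullet> (hessian f x *v h)"])
  show "(f has_derivative (\<lambda>h. h \<bullet> grad f y)) (at y)" for y
    using assms by (simp add: grad_has_derivative twice_differentiable_def)
  show "((\<lambda>y. u \<bullet> grad f y) has_derivative (\<lambda>h. u \<bullet> (hessian f x *v h))) (at x)" for u
    by (rule has_derivative_inner_right[OF grad_has_derivative_hessian[OF assms]])
  then show "((\<lambda>y. w \<bullet> grad f y) has_derivative (\<lambda>h. w \<bullet> (hessian f x *v h))) (at x)" .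
qed auto

section \<open>Derivatives within a submanifold\<close>

text \<open>Among possibly many derivatives within \<open>M\<close>,
  \<open>frechet_derivative\<close> picks one. Composition with a curve in \<open>M\<close> of
  velocity \<open>v\<close> turns each of them into a derivative in one real variable, which is
  unique, so any available derivative computes \<open>deriv_along\<close>.\<close>

lemma deriv_along_eq:
  assumes f: "(f has_derivative f') (at z within M)" and v: "v \<in> tangent_space M z"
  shows "deriv_along M f z v = f' v"
proof -
  obtain c e where c: "(0::real) < e" "c ` {-e<..<e} \<subseteq> M" "c 0 = z"
      "(c has_vector_derivative v) (at 0)"
    using v by (auto simp: tangent_space_def)
  have comp: "((\<lambda>t. f (c t)) has_vector_derivative D v) (at 0)"
    if D: "(f has_derivative D) (at z within M)" for D
  proof -
    have "(c has_derivative (\<lambda>h. h *\<^sub>R v)) (at 0 within {-e<..<e})"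
      using c(4) by (simp add: has_vector_derivative_def has_derivative_at_withinI)
    moreover have "(f has_derivative D) (at (c 0) within c ` {-e<..<e})"
      using D c(2,3) by (simp add: has_derivative_subset)
    ultimately have "((\<lambda>t. f (c t)) has_derivative (\<lambda>h. D (h *\<^sub>R v))) (at 0 within {-e<..<e})"
      by (rule has_derivative_in_compose)
    moreover have "at 0 within {-e<..<e} = at 0" using c(1) by (intro at_within_open) auto
    ultimately show ?thesis
      by (simp add: has_vector_derivative_def linear_cmul[OF has_derivative_linear[OF D]])
  qed
  have "(f has_derivative frechet_derivative f (at z within M)) (at z within M)"
    using f frechet_derivative_works differentiableI by blast
  from comp[OF this] comp[OF f] show ?thesis
    unfolding deriv_along_def by (rule vector_derivative_unique_at)
qed

lemma smooth_on_imp_differentiable: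
  assumes "smooth_on U g" and "x \<in> U"
  shows "g differentiable (at x)"
  using assms by (auto simp: smooth_on_def dest: spec[of _ "Suc 0"])

text \<open>The ambient derivative of a local smooth extension serves: since \<open>W\<close> is
  relatively open, the extension and the map agree on \<open>M\<close> near
  \<open>z\<close>.\<close>

lemma smooth_map_on_has_derivative:
  assumes "smooth_map_on W f" and "openin (top_of_set M) W" and "z \<in> W"
  obtains D where "(f has_derivative D) (at z within M)"
proof -
  obtain U g where g: "open U" "z \<in> U" "smooth_on U g" "\<And>x. x \<in> U \<inter> W \<Longrightarrow> g x = f x"
    using assms unfolding smooth_map_on_def by metis
  obtain T where T: "open T" "W = M \<inter> T" using assms(2) openin_open by blast
  obtain D where "(g has_derivative D) (at z)"
    using smooth_on_imp_differentiable[OF g(3,2)] by (auto simp: differentiable_def)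
  then have "(g has_derivative D) (at z within M)" by (rule has_derivative_at_withinI)
  moreover have "\<forall>\<^sub>F x in at z within M. g x = f x"
    unfolding eventually_at_topological
    by (rule exI[of _ "U \<inter> T"]) (use g(1,2,4) T assms(3) in \<open>auto simp: open_Int\<close>)
  ultimately have "(f has_derivative D) (at z within M)"
    by (rule has_derivative_transform_eventually) (use g(2,4) assms(3) T in auto)
  then show thesis by (rule that)
qed

section \<open>Smoothness along straight lines\<close>

lemma Ck_on_cong:
  assumes "open S" and "\<And>x. x \<in> S \<Longrightarrow> f x = g x" and "Ck_on k S f"
  shows "Ck_on k S g"
  using assms(2,3)
proof (induction k arbitrary: f g)
  case 0
  then show ?case by (simp cong: continuous_on_cong)
next
  case (Suc k)
  have diff: "f differentiable (at x)" if "x \<in> S" for x using Suc.prems that by simp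
  have D: "(g has_derivative frechet_derivative f (at x)) (at x)" if "x \<in> S" for x
    using diff[OF that, unfolded frechet_derivative_works]
    by (rule has_derivative_transform_within_open[OF _ assms(1) that]) (use Suc.prems in auto)
  have "frechet_derivative f (at x) v = frechet_derivative g (at x) v" if "x \<in> S" for x v
    using frechet_derivative_at[OF D[OF that]] by simp
  then have "Ck_on k S (\<lambda>x. frechet_derivative g (at x) v)" for v
    by (rule Suc.IH) (use Suc.prems in auto)
  moreover have "g differentiable (at x)" if "x \<in> S" for x
    using D[OF that] by (rule differentiableI)
  ultimately show ?case by simp
qed

lemma frechet_derivative_line:
  assumes "f differentiable (at (x + t *\<^sub>R a))"
  shows "((\<lambda>t. f (x + t *\<^sub>R a)) has_vector_derivative frechet_derivative f (at (x + t *\<^sub>R a)) a) (at t)"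
proof -
  have F: "(f has_derivative frechet_derivative f (at (x + t *\<^sub>R a))) (at (x + t *\<^sub>R a))"
    using assms by (simp add: frechet_derivative_works)
  have "((\<lambda>t. x + t *\<^sub>R a) has_derivative (\<lambda>h. h *\<^sub>R a)) (at t)"
    by (auto intro!: derivative_eq_intros)
  from has_derivative_compose[OF this F] linear_cmul[OF has_derivative_linear[OF F]]
  show ?thesis by (simp add: has_vector_derivative_def)
qed

text \<open>Each differentiation gives a directional derivative of \<open>f\<close> in a fixed
  direction \<open>h a\<close>, restricted to the line, so the induction closes. This provides the
  smooth curves that \<open>tangent_space\<close> asks for.\<close>

lemma Ck_on_line:
  fixes f :: "'a::real_normed_vector \<Rightarrow> 'b::real_normed_vector"
  assumes "open T" and "\<And>t. t \<in> T \<Longrightarrow> x + t *\<^sub>R a \<in> S" and "Ck_on k S f"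
  shows "Ck_on k T (\<lambda>t::real. f (x + t *\<^sub>R a))"
  using assms(3)
proof (induction k arbitrary: f)
  case 0
  have "continuous_on T (f \<circ> (\<lambda>t. x + t *\<^sub>R a))"
    by (rule continuous_on_compose) (use 0 assms(2) in \<open>auto intro!: continuous_intros
      intro: continuous_on_subset\<close>)
  then show ?case by (simp add: comp_def)
next
  case (Suc k)
  have vd: "((\<lambda>t. f (x + t *\<^sub>R a)) has_derivative
      (\<lambda>h. h *\<^sub>R frechet_derivative f (at (x + t *\<^sub>R a)) a)) (at t)" if "t \<in> T" for t
    using frechet_derivative_line[of f x t a] Suc.prems assms(2)[OF that]
    by (simp add: has_vector_derivative_def)
  have "frechet_derivative f (at (x + t *\<^sub>R a)) (h *\<^sub>R a) =
      frechet_derivative (\<lambda>t. f (x + t *\<^sub>R a)) (at t) h" if "t \<in> T" for t h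
  proof -
    have "f differentiable (at (x + t *\<^sub>R a))" using Suc.prems assms(2)[OF that] by simp
    then show ?thesis
      using frechet_derivative_at[OF vd[OF that]] linear_frechet_derivative linear_cmul
      by metis
  qed
  then have "Ck_on k T (\<lambda>t. frechet_derivative (\<lambda>t. f (x + t *\<^sub>R a)) (at t) h)" for h
    using Suc.prems
    by (intro Ck_on_cong[OF assms(1) _ Suc.IH[of "\<lambda>y. frechet_derivative f (at y) (h *\<^sub>R a)"]]) auto
  moreover have "(\<lambda>t. f (x + t *\<^sub>R a)) differentiable (at t)" if "t \<in> T" for t
    using vd[OF that] by (rule differentiableI)
  ultimately show ?case by simp
qed

lemma line_in_open:
  fixes x a :: "'a::real_normed_vector"
  assumes "open S" and "x \<in> S"
  obtains e where "0 < e" and "\<And>t. t \<in> {-e<..<e} \<Longrightarrow> x + t *\<^sub>R a \<in> S"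
proof -
  have "open ((\<lambda>t. x + t *\<^sub>R a) -` S)"
    by (rule open_vimage[OF assms(1)]) (auto intro!: continuous_intros)
  moreover have "0 \<in> (\<lambda>t. x + t *\<^sub>R a) -` S" using assms by simp
  ultimately obtain e where "0 < e" "ball 0 e \<subseteq> (\<lambda>t. x + t *\<^sub>R a) -` S"
    using open_contains_ball by meson
  then show thesis by (intro that[of e]) (auto simp: dist_real_def subset_eq)
qed

text \<open>Differentiating \<open>n(\<Psi>(x)) \<bullet> d\<Psi>(x) a = 0\<close> along a chart \<open>\<Psi>\<close> identifies the derivative of a
  normal field, paired with tangent vectors, with minus the second derivative of
  \<open>n(z) \<bullet> \<Psi>\<close>: symmetry is Schwarz's theorem, and the sign is the second-order condition for
  a maximum.\<close>

lemma
  fixes M W :: "'a::euclidean_space set"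
  assumes M: "smooth_submanifold d M" and W: "openin (top_of_set M) W" and z: "z \<in> W"
    and n: "\<And>x. x \<in> W \<Longrightarrow> n x \<in> orthogonal_comp (tangent_space M x)"
    and D: "(n has_derivative D) (at z within M)"
    and v: "v \<in> tangent_space M z"
  shows normal_field_derivative_symmetric:
      "w \<in> tangent_space M z \<Longrightarrow> v \<bullet> D w = w \<bullet> D v"
    and normal_field_derivative_nonneg:
      "(\<And>x. x \<in> M \<Longrightarrow> n z \<bullet> (x - z) \<le> 0) \<Longrightarrow> 0 \<le> v \<bullet> D v"
proof -
  obtain O' where O': "open O'" "W = M \<inter> O'" using W openin_open by blast
  have zM: "z \<in> M" using z O' by blast
  obtain U X L :: "'a set" and \<phi> \<Psi> :: "'a \<Rightarrow> 'a" where chart: "open U" "z \<in> U" "open X" "homeomorphism U X \<phi> \<Psi>"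
      "smooth_on U \<phi>" "smooth_on X \<Psi>" "subspace L" "\<phi> ` (U \<inter> M) = X \<inter> L"
    using bspec[OF M[unfolded smooth_submanifold_def] zM]
    by (elim exE conjE) (rule that; assumption)
  have \<phi>\<Psi>: "\<And>x. x \<in> X \<Longrightarrow> \<phi> (\<Psi> x) = x" and \<Psi>\<phi>: "\<And>x. x \<in> U \<Longrightarrow> \<Psi> (\<phi> x) = x"
    and \<Psi>X: "\<And>x. x \<in> X \<Longrightarrow> \<Psi> x \<in> U" and \<phi>U: "\<And>x. x \<in> U \<Longrightarrow> \<phi> x \<in> X"
    using chart(4) by (auto simp: homeomorphism_def)
  define y where "y = \<phi> z"
  have y: "y \<in> X" "y \<in> L" "\<Psi> y = z" using chart zM \<phi>U \<Psi>\<phi> by (auto simp: y_def)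
  have \<Psi>M: "\<Psi> x \<in> M" if "x \<in> X" "x \<in> L" for x
  proof -
    have "x \<in> \<phi> ` (U \<inter> M)" using that by (simp add: chart(8))
    then obtain u where "u \<in> U" "u \<in> M" "x = \<phi> u" by blast
    then show ?thesis by (simp add: \<Psi>\<phi>)
  qed
  have lineL: "x + t *\<^sub>R a \<in> L" if "x \<in> L" "a \<in> L" for x a t
    using that chart(7) by (simp add: subspace_add subspace_mul)
  define d\<Psi> where "d\<Psi> x = frechet_derivative \<Psi> (at x)" for x
  have d\<Psi>: "(\<Psi> has_derivative d\<Psi> x) (at x)" if "x \<in> X" for x
    using smooth_on_imp_differentiable[OF chart(6) that]
    by (simp add: d\<Psi>_def frechet_derivative_works)
  \<comment> \<open>\<open>E a b\<close> is the second derivative of the inverse chart at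
    \<open>y\<close> in the directions \<open>a\<close> and \<open>b\<close>.\<close>
  define E where "E a = frechet_derivative (\<lambda>x. d\<Psi> x a) (at y)" for a
  have E: "((\<lambda>x. d\<Psi> x a) has_derivative E a) (at y)" for a
  proof -
    have "Ck_on (Suc (Suc 0)) X \<Psi>" using chart(6) unfolding smooth_on_def by blast
    then show ?thesis using y(1) by (simp add: E_def d\<Psi>_def frechet_derivative_works)
  qed
  \<comment> \<open>Straight lines in the flat model \<open>L\<close> are mapped to smooth curves in
    \<open>M\<close>.\<close>
  have line_tangent: "d\<Psi> x a \<in> tangent_space M (\<Psi> x)" if x: "x \<in> X" "x \<in> L" and a: "a \<in> L" for x a
  proof -
    obtain e where e: "0 < e" "\<And>t. t \<in> {-e<..<e} \<Longrightarrow> x + t *\<^sub>R a \<in> X"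
      using line_in_open[OF chart(3) x(1)] by blast
    have "smooth_on {-e<..<e} (\<lambda>t. \<Psi> (x + t *\<^sub>R a))"
      using chart(6) e(2) unfolding smooth_on_def
      by (intro allI Ck_on_line[where S = X]) auto
    moreover have "(\<lambda>t. \<Psi> (x + t *\<^sub>R a)) ` {-e<..<e} \<subseteq> M"
      using e(2) x a by (auto intro!: \<Psi>M lineL)
    moreover have "((\<lambda>t. \<Psi> (x + t *\<^sub>R a)) has_vector_derivative d\<Psi> x a) (at 0)"
      using frechet_derivative_line[of \<Psi> x 0 a] smooth_on_imp_differentiable[OF chart(6) x(1)]
      by (simp add: d\<Psi>_def)
    ultimately show ?thesis using e(1) unfolding tangent_space_def by force
  qed
  \<comment> \<open>Conversely, a tangent vector \<open>u\<close> has the coordinate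
    \<open>d\<phi> u\<close>. The curve \<open>\<phi> (c t)\<close> stays in \<open>L\<close> near
    0, so its velocity is orthogonal to the orthogonal complement of \<open>L\<close> and hence lies
    in \<open>L\<close>.\<close>
  have coord: "\<exists>a\<in>L. d\<Psi> y a = u" if u: "u \<in> tangent_space M z" for u
  proof -
    obtain c e where c: "(0::real) < e" "c ` {-e<..<e} \<subseteq> M" "c 0 = z"
        "(c has_vector_derivative u) (at 0)"
      using u by (auto simp: tangent_space_def)
    obtain d\<phi> where d\<phi>: "(\<phi> has_derivative d\<phi>) (at z)"
      using smooth_on_imp_differentiable[OF chart(5,2)] by (auto simp: differentiable_def)
    have "((\<lambda>t. \<phi> (c t)) has_derivative (\<lambda>h. d\<phi> (h *\<^sub>R u))) (at 0)"
      using has_derivative_compose[of c _ 0 UNIV \<phi>] c(3,4) d\<phi> by (simp add: has_vector_derivative_def)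
    then have cd: "((\<lambda>t. \<phi> (c t)) has_vector_derivative d\<phi> u) (at 0)"
      using linear_cmul[OF has_derivative_linear[OF d\<phi>]] by (simp add: has_vector_derivative_def)
    have "orthogonal (d\<phi> u) q" if q: "q \<in> orthogonal_comp L" for q
    proof -
      have "isCont c 0" using c(4) by (rule has_vector_derivative_continuous)
      then have "\<forall>\<^sub>F t in at 0. c t \<in> U"
        using chart(1,2) c(3) by (auto simp: continuous_at intro: topological_tendstoD)
      moreover have "\<forall>\<^sub>F t in at 0. t \<in> {-e<..<e}"
        using c(1) by (intro eventually_at_in_open') auto
      ultimately have "\<forall>\<^sub>F t in at 0. \<phi> (c t) \<bullet> q = 0"
      proof eventually_elim
        case (elim t)
        then have "\<phi> (c t) \<in> L" using c(2) chart(8) by blast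
        then show ?case using q by (auto simp: orthogonal_comp_def orthogonal_def)
      qed
      moreover have "\<phi> (c 0) \<bullet> q = 0"
        using q y(2) c(3) by (auto simp: y_def orthogonal_comp_def orthogonal_def)
      moreover have "((\<lambda>t. \<phi> (c t) \<bullet> q) has_derivative (\<lambda>h. (h *\<^sub>R d\<phi> u) \<bullet> q)) (at 0)"
        using cd unfolding has_vector_derivative_def by (rule has_derivative_inner_left)
      ultimately have "((\<lambda>t. 0) has_derivative (\<lambda>h. (h *\<^sub>R d\<phi> u) \<bullet> q)) (at (0::real))"
        using has_derivative_transform_eventually[of _ _ 0 UNIV "\<lambda>t. 0"] by simp
      then have "(\<lambda>h. (h *\<^sub>R d\<phi> u) \<bullet> q) = (\<lambda>h. 0)"
        by (rule has_derivative_unique) simp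
      then show ?thesis by (metis inner_scaleR_left mult_1 orthogonal_def)
    qed
    then have "d\<phi> u \<in> orthogonal_comp (orthogonal_comp L)"
      by (auto simp: orthogonal_comp_def orthogonal_commute)
    then have "d\<phi> u \<in> L" by (simp add: orthogonal_comp_self chart(7))
    moreover have "d\<Psi> y (d\<phi> u) = u"
    proof -
      have "(\<Psi> has_derivative d\<Psi> y) (at (\<phi> z))" using d\<Psi>[OF y(1)] by (simp add: y_def)
      from has_derivative_compose[OF d\<phi> this]
      have "((\<lambda>x. x) has_derivative (\<lambda>h. d\<Psi> y (d\<phi> h))) (at z)"
        by (rule has_derivative_transform_within_open[OF _ chart(1,2)]) (simp add: \<Psi>\<phi>)
      then have "(\<lambda>h. d\<Psi> y (d\<phi> h)) = (\<lambda>h. h)"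
        by (rule has_derivative_unique) simp
      then show ?thesis by metis
    qed
    ultimately show ?thesis by blast
  qed
  have key: "d\<Psi> y a \<bullet> D (d\<Psi> y b) = - (n z \<bullet> E a b)" if a: "a \<in> L" and b: "b \<in> L" for a b
  proof -
    \<comment> \<open>The interval is short enough for the line to stay in the chart and for its
      image to stay in \<open>O'\<close>, hence in \<open>W\<close>, where \<open>n\<close> is
      normal.\<close>
    obtain e where e: "0 < e" "\<And>t. t \<in> {-e<..<e} \<Longrightarrow> y + t *\<^sub>R b \<in> X \<inter> \<Psi> -` O'"
    proof (rule line_in_open[where a = b])
      show "open (X \<inter> \<Psi> -` O')"
        by (rule continuous_open_preimage[OF _ chart(3) O'(1)])
          (use chart(4) in \<open>simp add: homeomorphism_def\<close>)
      show "y \<in> X \<inter> \<Psi> -` O'" using y z O' by simp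
    qed blast
    let ?T = "{-e<..<e}"
    have lineM: "(\<lambda>t. \<Psi> (y + t *\<^sub>R b)) ` ?T \<subseteq> M"
      using e(2) y(2) b by (auto intro!: \<Psi>M lineL)
    \<comment> \<open>\<open>D\<close> is a derivative within \<open>M\<close>, so the chain rule
      runs within \<open>?T\<close>, whose image lies in \<open>M\<close>. As \<open>?T\<close> is
      open, the outcome is an ordinary derivative at 0 and therefore unique.\<close>
    have T: "at 0 within ?T = at 0" using e(1) by (intro at_within_open) auto
    have zero: "n (\<Psi> (y + t *\<^sub>R b)) \<bullet> d\<Psi> (y + t *\<^sub>R b) a = 0" if "t \<in> ?T" for t
    proof -
      have "\<Psi> (y + t *\<^sub>R b) \<in> W" using e(2) O' lineM that by auto
      from n[OF this] line_tangent[OF _ lineL[OF y(2) b] a] e(2)[OF that] show ?thesis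
        by (auto simp: orthogonal_comp_def orthogonal_def inner_commute)
    qed
    have "((\<lambda>t. n (\<Psi> (y + t *\<^sub>R b)) \<bullet> d\<Psi> (y + t *\<^sub>R b) a) has_derivative
        (\<lambda>h. n (\<Psi> (y + 0 *\<^sub>R b)) \<bullet> (h *\<^sub>R E a b) + (h *\<^sub>R D (d\<Psi> y b)) \<bullet> d\<Psi> (y + 0 *\<^sub>R b) a)) (at 0 within ?T)"
    proof (rule has_derivative_inner)
      have line: "((\<lambda>t. y + t *\<^sub>R b) has_derivative (\<lambda>h. h *\<^sub>R b)) (at 0)"
        by (auto intro!: derivative_eq_intros)
      have "((\<lambda>t. d\<Psi> (y + t *\<^sub>R b) a) has_derivative (\<lambda>h. E a (h *\<^sub>R b))) (at 0)"
        using has_derivative_compose[OF line, of "\<lambda>x. d\<Psi> x a" "E a"] E by simp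
      then show "((\<lambda>t. d\<Psi> (y + t *\<^sub>R b) a) has_derivative (\<lambda>h. h *\<^sub>R E a b)) (at 0 within ?T)"
        by (simp add: linear_cmul[OF has_derivative_linear[OF E]] has_derivative_at_withinI)
      have "((\<lambda>t. \<Psi> (y + t *\<^sub>R b)) has_derivative (\<lambda>h. d\<Psi> y (h *\<^sub>R b))) (at 0 within ?T)"
        using has_derivative_compose[OF line, of \<Psi> "d\<Psi> y"] d\<Psi>[OF y(1)]
        by (simp add: has_derivative_at_withinI)
      moreover have "(n has_derivative D) (at (\<Psi> (y + 0 *\<^sub>R b)) within (\<lambda>t. \<Psi> (y + t *\<^sub>R b)) ` ?T)"
        using D lineM y(3) by (simp add: has_derivative_subset)
      ultimately have "((\<lambda>t. n (\<Psi> (y + t *\<^sub>R b))) has_derivative (\<lambda>h. D (d\<Psi> y (h *\<^sub>R b)))) (at 0 within ?T)"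
        by (rule has_derivative_in_compose)
      then show "((\<lambda>t. n (\<Psi> (y + t *\<^sub>R b))) has_derivative (\<lambda>h. h *\<^sub>R D (d\<Psi> y b))) (at 0 within ?T)"
        by (simp add: linear_cmul[OF has_derivative_linear[OF D]]
            linear_cmul[OF has_derivative_linear[OF d\<Psi>[OF y(1)]]])
    qed
    then have "((\<lambda>t. n (\<Psi> (y + t *\<^sub>R b)) \<bullet> d\<Psi> (y + t *\<^sub>R b) a) has_derivative
        (\<lambda>h. n z \<bullet> (h *\<^sub>R E a b) + (h *\<^sub>R D (d\<Psi> y b)) \<bullet> d\<Psi> y a)) (at 0)"
      unfolding T scaleR_zero_left add_0_right y(3) .
    then have "((\<lambda>t. 0) has_derivative
        (\<lambda>h. n z \<bullet> (h *\<^sub>R E a b) + (h *\<^sub>R D (d\<Psi> y b)) \<bullet> d\<Psi> y a)) (at (0::real))"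
      by (rule has_derivative_transform_within_open[of _ _ _ _ ?T]) (use e(1) zero in auto)
    then have "(\<lambda>h. n z \<bullet> (h *\<^sub>R E a b) + (h *\<^sub>R D (d\<Psi> y b)) \<bullet> d\<Psi> y a) = (\<lambda>h. 0)"
      by (rule has_derivative_unique) simp
    from fun_cong[OF this, of 1] show ?thesis by (simp add: inner_commute)
  qed
  have d\<Psi>n: "((\<lambda>x. n z \<bullet> \<Psi> x) has_derivative (\<lambda>h. n z \<bullet> d\<Psi> x h)) (at x)" if "x \<in> X" for x
    by (rule has_derivative_inner_right[OF d\<Psi>[OF that]])
  have En: "((\<lambda>x. n z \<bullet> d\<Psi> x a) has_derivative (\<lambda>h. n z \<bullet> E a h)) (at y)" for a
    by (rule has_derivative_inner_right[OF E])
  obtain a where a: "a \<in> L" "d\<Psi> y a = v" using coord[OF v] by blast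
  show "v \<bullet> D w = w \<bullet> D v" if w: "w \<in> tangent_space M z"
  proof -
    obtain b where b: "b \<in> L" "d\<Psi> y b = w" using coord[OF w] by blast
    have "n z \<bullet> E a b = n z \<bullet> E b a"
      by (rule second_derivative_symmetric[OF chart(3) y(1) d\<Psi>n En En])
    then show ?thesis using key[OF a(1) b(1)] key[OF b(1) a(1)] a(2) b(2) by simp
  qed
  show "0 \<le> v \<bullet> D v" if max: "\<And>x. x \<in> M \<Longrightarrow> n z \<bullet> (x - z) \<le> 0"
  proof (rule ccontr)
    assume "\<not> 0 \<le> v \<bullet> D v"
    then have pos: "0 < n z \<bullet> E a a" using key[OF a(1) a(1)] a(2) by simp
    \<comment> \<open>The height \<open>k\<close> of the curve in direction \<open>n z\<close> has
      \<open>k' 0 = 0\<close>, because \<open>n z\<close> is normal, and a positive second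
      derivative at 0 by \<open>pos\<close>. So \<open>k\<close> exceeds \<open>k 0\<close> just to
      the right of 0, against maximality at \<open>z\<close>.\<close>
    define k where "k t = n z \<bullet> \<Psi> (y + t *\<^sub>R a)" for t
    define k' where "k' t = n z \<bullet> d\<Psi> (y + t *\<^sub>R a) a" for t
    obtain e where e: "0 < e" "\<And>t. t \<in> {-e<..<e} \<Longrightarrow> y + t *\<^sub>R a \<in> X"
      using line_in_open[OF chart(3) y(1)] by blast
    have line: "((\<lambda>t. y + t *\<^sub>R a) has_derivative (\<lambda>h. h *\<^sub>R a)) (at t)" for t
      by (auto intro!: derivative_eq_intros)
    have k: "(k has_real_derivative k' t) (at t)" if "t \<in> {-e<..<e}" for t
      using has_derivative_compose[OF line d\<Psi>n[OF e(2)[OF that]]]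
        linear_cmul[OF has_derivative_linear[OF d\<Psi>[OF e(2)[OF that]]]]
      by (simp add: k_def[abs_def] k'_def has_field_derivative_def mult_commute_abs)
    have "(k' has_real_derivative n z \<bullet> E a a) (at 0)"
      using has_derivative_compose[OF line[of 0], of "\<lambda>x. n z \<bullet> d\<Psi> x a" "\<lambda>h. n z \<bullet> E a h"] En[of a]
        linear_cmul[OF has_derivative_linear[OF E]]
      by (simp add: k'_def[abs_def] has_field_derivative_def mult_commute_abs)
    from DERIV_pos_inc_right[OF this pos] obtain r where r: "0 < r" "\<And>h. 0 < h \<Longrightarrow> h < r \<Longrightarrow> k' 0 < k' h"
      by auto
    have "k' 0 = 0"
      using n[OF z] a v by (auto simp: k'_def orthogonal_comp_def orthogonal_def inner_commute)
    define t where "t = min e r / 2"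
    have t: "0 < t" "t < e" "t < r" using e(1) r(1) by (auto simp: t_def)
    obtain \<xi> where \<xi>: "0 < \<xi>" "\<xi> < t" "k t - k 0 = (t - 0) * k' \<xi>"
      using MVT2[of 0 t k k'] t k by force
    then have "0 < k t - k 0" using r(2)[of \<xi>] t \<open>k' 0 = 0\<close> by simp
    moreover have "\<Psi> (y + t *\<^sub>R a) \<in> M"
      using e(2)[of t] t y(2) a(1) chart(7) by (intro \<Psi>M lineL) auto
    then have "k t - k 0 \<le> 0" using max y(3) by (force simp: k_def inner_diff_right)
    ultimately show False by simp
  qed
qed

section \<open>The metric\<close>

lemma matrix_inv_inverse:
  fixes Q :: "real^'p^'p"
  assumes "invertible Q"
  shows "Q ** matrix_inv Q = mat 1" and "matrix_inv Q ** Q = mat 1"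
proof -
  have "Q ** matrix_inv Q = mat 1 \<and> matrix_inv Q ** Q = mat 1"
    using assms unfolding invertible_def matrix_inv_def by (rule someI_ex)
  then show "Q ** matrix_inv Q = mat 1" and "matrix_inv Q ** Q = mat 1" by simp_all
qed

lemma pos_definite_invertible: "pos_definite Q \<Longrightarrow> invertible Q"
  using pos_definite_det_pos[of Q] by (simp add: invertible_det_nz)

text \<open>The metric is given by the inverse of \<open>Q\<close>, whereas the derivatives of
  \<open>psi\<close> carry a factor \<open>Q\<close>; the two cancel and leave a Euclidean
  product.\<close>

lemma riem_mult_right: "pos_definite Q \<Longrightarrow> riem Q v (Q *v w) = v \<bullet> w"
  by (simp add: riem_def matrix_vector_mul_assoc matrix_inv_inverse pos_definite_invertible)

lemma pos_definite_surj:
  assumes "pos_definite Q"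
  obtains v' where "v = Q *v v'"
proof
  show "v = Q *v (matrix_inv Q *v v)"
    using assms by (simp add: matrix_vector_mul_assoc matrix_inv_inverse pos_definite_invertible)
qed

lemma riem_add_right: "riem Q u (v + w) = riem Q u v + riem Q u w"
  and riem_diff_left: "riem Q (u - v) w = riem Q u w - riem Q v w"
  and riem_scale_right: "riem Q u (c *\<^sub>R v) = c * riem Q u v"
  by (simp_all add: riem_def algebra_simps matrix_vector_mult_scaleR
      inner_diff_left inner_add_right)

lemma riem_zero_right: "riem Q u 0 = 0"
  by (simp add: riem_def)

lemma riem_sum_left: "riem Q (\<Sum>j\<in>J. a j *\<^sub>R b j) v = (\<Sum>j\<in>J. a j * riem Q (b j) v)"
  by (simp add: riem_def inner_sum_left)

text \<open>The substitution \<open>v = Q *v v'\<close> turns the form of the inverse into that of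
  \<open>Q\<close>.\<close>

lemma riem_pos:
  assumes "pos_definite Q" and "v \<noteq> 0"
  shows "0 < riem Q v v"
proof -
  obtain v' where v': "v = Q *v v'" using pos_definite_surj[OF assms(1)] .
  then have "v' \<noteq> 0" using assms(2) by auto
  then show ?thesis
    using assms(1) by (simp add: v' riem_mult_right pos_definite_def inner_commute)
qed

text \<open>The same substitution carries the symmetry of \<open>Q\<close> over to its
  inverse.\<close>

lemma riem_commute:
  assumes "pos_definite Q" and sym: "\<And>v w. v \<bullet> (Q *v w) = w \<bullet> (Q *v v)"
  shows "riem Q v w = riem Q w v"
proof -
  obtain v' w' where "v = Q *v v'" "w = Q *v w'"
    using pos_definite_surj[OF assms(1)] by metis
  then show ?thesis
    using sym[of v' w'] by (simp add: riem_mult_right assms(1) inner_commute)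
qed

section \<open>Determinants of pairings with an orthonormal frame\<close>

lemma bilinear_sum:
  fixes b :: "'i \<Rightarrow> 'a::euclidean_space"
  assumes "linear f"
  shows "(\<Sum>j\<in>J. \<Sum>k\<in>J. a j * (b j \<bullet> f (b k)) * a k) =
    (\<Sum>j\<in>J. a j *\<^sub>R b j) \<bullet> f (\<Sum>j\<in>J. a j *\<^sub>R b j)"
  unfolding linear_sum[OF assms] linear_cmul[OF assms] inner_sum_left
  unfolding inner_sum_right by (simp add: mult_ac)

text \<open>By orthonormality a nonzero coefficient family yields a nonzero vector of the span,
  where the form is positive. Both \<open>G\<close> and \<open>G + C\<close> are matrices of this
  kind.\<close>

lemma det_on_bilinear_pos:
  fixes b :: "'p::finite \<Rightarrow> 'a::euclidean_space"
  assumes "linear f" and "\<And>i j. i \<in> J \<Longrightarrow> j \<in> J \<Longrightarrow> b i \<bullet> b j = (if i = j then 1 else 0)"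
    and pos: "\<And>v. v \<in> span (b ` J) \<Longrightarrow> v \<noteq> 0 \<Longrightarrow> 0 < v \<bullet> f v"
  shows "0 < det_on J (\<lambda>j k. b j \<bullet> f (b k))"
proof (rule det_on_pos)
  fix a assume "\<exists>j\<in>J. a j \<noteq> (0::real)"
  then obtain j where j: "j \<in> J" "a j \<noteq> 0" by blast
  let ?v = "\<Sum>j\<in>J. a j *\<^sub>R b j"
  have "b j \<bullet> ?v = (\<Sum>k\<in>J. if k = j then a j else 0)"
    unfolding inner_sum_right by (rule sum.cong) (use assms(2) j in auto)
  then have "?v \<noteq> 0" using j by auto
  moreover have "?v \<in> span (b ` J)" by (intro span_sum span_scale span_base) auto
  ultimately show "0 < (\<Sum>j\<in>J. \<Sum>k\<in>J. a j * (b j \<bullet> f (b k)) * a k)"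
    unfolding bilinear_sum[OF assms(1)] by (intro pos)
qed

text \<open>The factorization \<open>G + C = G (I + G^{-1} C)\<close> and multiplicativity of the
  determinant.\<close>

lemma det_on_add:
  fixes J :: "'p::finite set"
  assumes "det_on J G \<noteq> 0"
  shows "det_on J (\<lambda>j k. G j k + C j k) =
    det_on J G * det_on J (\<lambda>j k. (if j = k then 1 else 0) + (\<Sum>m\<in>J. inv_on J G j m * C m k))"
  unfolding det_on_mult
proof (rule det_on_cong)
  fix i k assume ik: "i \<in> J" "k \<in> J"
  have "(\<Sum>j\<in>J. G i j * (\<Sum>m\<in>J. inv_on J G j m * C m k)) =
      (\<Sum>m\<in>J. (\<Sum>j\<in>J. G i j * inv_on J G j m) * C m k)"
    by (simp add: sum_distrib_left sum_distrib_right mult.assoc) (rule sum.swap)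
  also have "\<dots> = (\<Sum>m\<in>J. if m = i then C m k else 0)"
    by (rule sum.cong) (use ik inv_on_right[OF assms] in auto)
  also have "\<dots> = C i k" using ik by simp
  moreover have "(\<Sum>j\<in>J. G i j * (if j = k then 1 else 0)) = (\<Sum>j\<in>J. if j = k then G i j else 0)"
    by (rule sum.cong) auto
  ultimately show "G i k + C i k =
      (\<Sum>j\<in>J. G i j * ((if j = k then 1 else 0) + (\<Sum>m\<in>J. inv_on J G j m * C m k)))"
    using ik by (simp add: distrib_left sum.distrib)
qed

text \<open>With the two families as columns of matrices \<open>B\<close> and \<open>X\<close>, the
  matrix of pairings is \<open>B^T N X\<close>.\<close>

lemma det_bilinear:
  fixes N :: "real^'p^'p" and b x :: "'p \<Rightarrow> real^'p"
  shows "det (\<chi> i j. b i \<bullet> (N *v x j)) = det (\<chi> r c. b c $ r) * det N * det (\<chi> r c. x c $ r)"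
proof -
  have "(\<chi> i j. b i \<bullet> (N *v x j)) = transpose (\<chi> r c. b c $ r) ** (N ** (\<chi> r c. x c $ r))"
    by (simp add: vec_eq_iff inner_vec_def matrix_matrix_mult_def matrix_vector_mult_def transpose_def)
  then show ?thesis by (simp add: det_mul)
qed

lemma det_inner:
  fixes b x :: "'p::finite \<Rightarrow> real^'p"
  shows "det (\<chi> i j. b i \<bullet> x j) = det (\<chi> r c. b c $ r) * det (\<chi> r c. x c $ r)"
  using det_bilinear[of b "mat 1" x] by simp

lemma det_orthonormal_squared:
  fixes b :: "'p::finite \<Rightarrow> real^'p"
  assumes "\<And>i j. b i \<bullet> b j = (if i = j then 1 else 0)"
  shows "(det (\<chi> r c. b c $ r))\<^sup>2 = 1"
proof -
  have "(\<chi> i j. b i \<bullet> b j) = mat 1" by (simp add: assms mat_def)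
  then show ?thesis using det_inner[of b b] by (simp add: power2_eq_square)
qed

lemma det_matrix_inv:
  fixes Q :: "real^'p^'p"
  assumes "invertible Q"
  shows "det (matrix_inv Q) * det Q = 1"
  using matrix_inv_inverse(2)[OF assms] by (metis det_I det_mul)

text \<open>The matrix of pairings is \<open>B^T Q^{-1} X\<close> with \<open>B\<close> orthogonal,
  and it is block triangular with the identity as its block on \<open>I\<close>. Comparing
  determinants gives the formula up to sign, and \<open>pos\<close> settles the sign.\<close>

lemma jacobian_determinant:
  fixes b x :: "'p::finite \<Rightarrow> real^'p"
  assumes AI: "A \<inter> I = {}" "A \<union> I = UNIV"
    and b: "\<And>i j. b i \<bullet> b j = (if i = j then 1 else 0)"
    and Q: "pos_definite Q"
    and zero: "\<And>j i. j \<in> A \<Longrightarrow> i \<in> I \<Longrightarrow> riem Q (b j) (x i) = 0"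
    and one: "\<And>i l. i \<in> I \<Longrightarrow> l \<in> I \<Longrightarrow> riem Q (b i) (x l) = (if i = l then 1 else 0)"
    and pos: "0 < det_on A (\<lambda>j k. riem Q (b j) (x k))"
  shows "\<bar>det (\<chi> r c. x c $ r)\<bar> = det Q * det_on A (\<lambda>j k. riem Q (b j) (x k))"
proof -
  let ?D = "det_on A (\<lambda>j k. riem Q (b j) (x k))"
  have "det (\<chi> i j. riem Q (b i) (x j)) = ?D * det_on I (\<lambda>i l. riem Q (b i) (x l))"
    by (rule det_block_triangular[OF AI]) (rule zero)
  also have "det_on I (\<lambda>i l. riem Q (b i) (x l)) = det_on I (\<lambda>i l. if i = l then 1 else 0)"
    by (rule det_on_cong) (rule one)
  finally have "?D = det (\<chi> r c. b c $ r) * det (matrix_inv Q) * det (\<chi> r c. x c $ r)"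
    by (simp add: det_on_identity riem_def det_bilinear)
  then have "det Q * ?D = det (\<chi> r c. b c $ r) * (det (matrix_inv Q) * det Q) * det (\<chi> r c. x c $ r)"
    by simp
  then have eq: "det Q * ?D = det (\<chi> r c. b c $ r) * det (\<chi> r c. x c $ r)"
    by (simp add: det_matrix_inv pos_definite_invertible Q)
  have "\<bar>det (\<chi> r c. b c $ r)\<bar> = 1"
    using det_orthonormal_squared[OF b] by (auto simp: power2_eq_1_iff)
  then have "\<bar>det (\<chi> r c. x c $ r)\<bar> = \<bar>det Q * ?D\<bar>"
    unfolding eq abs_mult by simp
  also have "\<dots> = det Q * ?D" using pos pos_definite_det_pos[OF Q] by simp
  finally show ?thesis .
qed

section \<open>Orthogonal projection in the metric\<close>

text \<open>That \<open>n\<close> qualifies follows from the symmetry of the metric. If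
  \<open>w\<close> qualifies too, then \<open>w - n\<close> lies in the complement and is orthogonal
  to itself, so it vanishes by positivity.\<close>

lemma form_projection_eqI:
  fixes Q :: "real^'p^'p"
  assumes Q: "pos_definite Q" "\<And>v w. v \<bullet> (Q *v w) = w \<bullet> (Q *v v)"
    and n: "n \<in> form_complement (riem Q) T" and T: "v - n \<in> T"
  shows "form_projection (riem Q) (form_complement (riem Q) T) v = n"
  unfolding form_projection_def
proof (rule the_equality)
  show P: "n \<in> form_complement (riem Q) T \<and> (\<forall>u\<in>form_complement (riem Q) T. riem Q (v - n) u = 0)"
    using n T riem_commute[OF Q] by (auto simp: form_complement_def)
  fix w
  assume w: "w \<in> form_complement (riem Q) T \<and> (\<forall>u\<in>form_complement (riem Q) T. riem Q (v - w) u = 0)"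
  have "w - n \<in> form_complement (riem Q) T"
    using w n by (simp add: form_complement_def riem_diff_left)
  then have "riem Q (v - n) (w - n) - riem Q (v - w) (w - n) = 0" using P w by auto
  then have "riem Q (w - n) (w - n) = 0" by (simp flip: riem_diff_left)
  then show "w = n" using riem_pos[OF Q(1), of "w - n"] by force
qed

text \<open>The Gram matrix of the spanning vectors is invertible, so the normal equations can be
  solved for the tangential part \<open>t\<close> of \<open>v\<close>; the projection is the
  remainder \<open>v - t\<close>.\<close>

lemma form_projection_span:
  fixes Q :: "real^'p^'p" and b :: "'p \<Rightarrow> real^'p"
  assumes Q: "pos_definite Q" "\<And>v w. v \<bullet> (Q *v w) = w \<bullet> (Q *v v)"
    and det: "det_on A (\<lambda>j k. riem Q (b j) (b k)) \<noteq> 0"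
  defines "P \<equiv> form_projection (riem Q) (form_complement (riem Q) (span (b ` A)))"
  shows "P v \<in> form_complement (riem Q) (span (b ` A))" and "v - P v \<in> span (b ` A)"
proof -
  let ?G = "\<lambda>j k. riem Q (b j) (b k)"
  define a where "a j = (\<Sum>m\<in>A. inv_on A ?G j m * riem Q (b m) v)" for j
  define t where "t = (\<Sum>j\<in>A. a j *\<^sub>R b j)"
  have t: "t \<in> span (b ` A)"
    unfolding t_def by (intro span_sum span_scale span_base) auto
  have zero: "riem Q (v - t) (b k) = 0" if k: "k \<in> A" for k
  proof -
    have "riem Q t (b k) = (\<Sum>j\<in>A. ?G k j * a j)"
      unfolding t_def riem_sum_left
      by (rule sum.cong) (simp_all add: riem_commute[OF Q, of "b k"] mult.commute)
    also have "\<dots> = (\<Sum>m\<in>A. (\<Sum>j\<in>A. ?G k j * inv_on A ?G j m) * riem Q (b m) v)"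
      unfolding a_def by (simp add: sum_distrib_left sum_distrib_right mult.assoc) (rule sum.swap)
    also have "\<dots> = (\<Sum>m\<in>A. if m = k then riem Q (b m) v else 0)"
      by (rule sum.cong) (use k inv_on_right[OF det] in auto)
    also have "\<dots> = riem Q v (b k)" using k riem_commute[OF Q] by simp
    finally show ?thesis by (simp add: riem_diff_left)
  qed
  have "riem Q (v - t) u = 0" if "u \<in> span (b ` A)" for u
    using that
    by (induction rule: span_induct_alt)
      (auto simp: riem_zero_right riem_add_right riem_scale_right zero)
  then have n: "v - t \<in> form_complement (riem Q) (span (b ` A))" by (simp add: form_complement_def)
  then have "P v = v - t"
    unfolding P_def by (rule form_projection_eqI[OF Q]) (simp add: t)
  then show "P v \<in> form_complement (riem Q) (span (b ` A))" and "v - P v \<in> span (b ` A)"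
    using n t by simp_all
qed

text \<open>The identity is obtained from the Gram matrix of the basis consisting of the tangent frame and the
  projected normal frame; passing to it from \<open>b\<close> is a unipotent change of basis.\<close>

lemma det_gram_complement:
  fixes Q :: "real^'p^'p" and b :: "'p \<Rightarrow> real^'p"
  assumes AI: "A \<inter> I = {}" "A \<union> I = UNIV"
    and b: "\<And>i j. b i \<bullet> b j = (if i = j then 1 else 0)"
    and Q: "pos_definite Q" "\<And>v w. v \<bullet> (Q *v w) = w \<bullet> (Q *v v)"
    and det: "det_on A (\<lambda>j k. riem Q (b j) (b k)) \<noteq> 0"
  defines "P \<equiv> form_projection (riem Q) (form_complement (riem Q) (span (b ` A)))"
  shows "det_on A (\<lambda>j k. riem Q (b j) (b k)) * det_on I (\<lambda>i l. riem Q (P (b i)) (P (b l))) * det Q = 1"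
proof -
  have P: "P v \<in> form_complement (riem Q) (span (b ` A))" "v - P v \<in> span (b ` A)" for v
    using form_projection_span[OF Q det] by (simp_all add: P_def)
  have IA: "I \<inter> A = {}" "I \<union> A = UNIV" using AI by auto
  then have nA: "i \<notin> A" if "i \<in> I" for i using that by blast
  define x where "x c = (if c \<in> A then b c else P (b c))" for c
  \<comment> \<open>\<open>b l - P (b l)\<close> is tangent and \<open>b i\<close> is normal in the
    Euclidean sense, so projecting \<open>b l\<close> does not change its product with
    \<open>b i\<close>.\<close>
  have bP: "b i \<bullet> P (b l) = (if i = l then 1 else 0)" if "i \<in> I" for i l
  proof -
    have "orthogonal (b i) (b l - P (b l))"
      by (rule orthogonal_to_span[OF P(2)]) (use that nA b in \<open>auto simp: orthogonal_def\<close>)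
    then show ?thesis by (simp add: orthogonal_def inner_diff_right b)
  qed
  \<comment> \<open>Here \<open>I\<close> is the first block: Euclidean products of normal with
    tangent frame vectors vanish, while a projected normal vector may have a tangential Euclidean
    component.\<close>
  have "det (\<chi> i j. b i \<bullet> x j) = det_on I (\<lambda>i j. b i \<bullet> x j) * det_on A (\<lambda>i j. b i \<bullet> x j)"
    by (rule det_block_triangular[OF IA]) (use b nA in \<open>auto simp: x_def\<close>)
  also have "det_on I (\<lambda>i j. b i \<bullet> x j) = det_on I (\<lambda>i j. if i = j then 1 else 0)"
    by (rule det_on_cong) (simp add: x_def bP nA)
  also have "det_on A (\<lambda>i j. b i \<bullet> x j) = det_on A (\<lambda>i j. if i = j then 1 else 0)"
    by (rule det_on_cong) (simp add: x_def b)
  finally have "det (\<chi> r c. b c $ r) * det (\<chi> r c. x c $ r) = 1"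
    by (simp add: det_on_identity det_inner)
  then have x2: "(det (\<chi> r c. x c $ r))\<^sup>2 = 1"
    using det_orthonormal_squared[OF b] by (metis mult_1 power_mult_distrib power_one)
  \<comment> \<open>In the metric the projected vectors are orthogonal to the tangent frame, so the
    Gram determinant splits into the two factors of the claim.\<close>
  have "det (\<chi> i j. riem Q (x i) (x j)) =
      det_on A (\<lambda>i j. riem Q (x i) (x j)) * det_on I (\<lambda>i j. riem Q (x i) (x j))"
  proof (rule det_block_triangular[OF AI])
    fix i j assume "i \<in> A" "j \<in> I"
    then show "riem Q (x i) (x j) = 0"
      using P(1)[of "b j"] nA riem_commute[OF Q, of "b i"]
      by (auto simp: x_def form_complement_def span_base)
  qed
  also have "det_on A (\<lambda>i j. riem Q (x i) (x j)) = det_on A (\<lambda>j k. riem Q (b j) (b k))"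
    by (rule det_on_cong) (simp add: x_def)
  also have "det_on I (\<lambda>i j. riem Q (x i) (x j)) = det_on I (\<lambda>i l. riem Q (P (b i)) (P (b l)))"
    by (rule det_on_cong) (simp add: x_def nA)
  finally have "det_on A (\<lambda>j k. riem Q (b j) (b k)) * det_on I (\<lambda>i l. riem Q (P (b i)) (P (b l))) =
      (det (\<chi> r c. x c $ r))\<^sup>2 * det (matrix_inv Q)"
    by (simp add: riem_def det_bilinear power2_eq_square mult_ac)
  then show ?thesis
    by (simp add: x2 det_matrix_inv pos_definite_invertible Q(1))
qed

section \<open>The Jacobian\<close>

text \<open>The Weingarten relation: the product rule for \<open>n \<bullet> Y = 0\<close> trades
  the derivative of the tangent field for that of the normal field, at the cost of a sign.\<close>

lemma normal_tangent_derivative: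
  fixes n Y :: "'a::euclidean_space \<Rightarrow> 'a"
  assumes W: "openin (top_of_set M) W" and z: "z \<in> W"
    and n: "(n has_derivative D) (at z within M)"
    and Y: "(Y has_derivative DY) (at z within M)"
    and orth: "\<And>x. x \<in> W \<Longrightarrow> n x \<bullet> Y x = 0"
    and v: "v \<in> tangent_space M z"
  shows "n z \<bullet> DY v = - (D v \<bullet> Y z)"
proof -
  obtain T where T: "open T" "W = M \<inter> T" using W openin_open by blast
  have "((\<lambda>x. n x \<bullet> Y x) has_derivative (\<lambda>h. n z \<bullet> DY h + D h \<bullet> Y z)) (at z within M)"
    using n Y by (rule has_derivative_inner)
  from deriv_along_eq[OF this v]
  have "deriv_along M (\<lambda>x. n x \<bullet> Y x) z v = n z \<bullet> DY v + D v \<bullet> Y z" .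
  moreover have "\<forall>\<^sub>F x in at z within M. 0 = n x \<bullet> Y x"
    unfolding eventually_at_topological
    by (rule exI[of _ T]) (use T z orth in auto)
  then have "((\<lambda>x. n x \<bullet> Y x) has_derivative (\<lambda>h. 0)) (at z within M)"
    by (rule has_derivative_transform_eventually[OF has_derivative_const]) (use T z orth in auto)
  from deriv_along_eq[OF this v] have "deriv_along M (\<lambda>x. n x \<bullet> Y x) z v = 0" .
  ultimately show ?thesis by simp
qed

section \<open>The derivatives of \<open>psi\<close>\<close>

lemma reg_hessian_mult: "reg_hessian f \<epsilon> x *v v = hessian f x *v v + \<epsilon> *\<^sub>R v"
  by (simp add: reg_hessian_def matrix_vector_mult_add_rdistrib flip: scaleR_matrix_vector_assoc)

lemma reg_gradient_has_derivative:
  assumes "twice_differentiable f"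
  shows "((\<lambda>x. grad f x + \<epsilon> *\<^sub>R x) has_derivative (\<lambda>v. reg_hessian f \<epsilon> x *v v)) (at x)"
  unfolding reg_hessian_mult
  by (intro has_derivative_add grad_has_derivative_hessian assms has_derivative_scaleR_right
      has_derivative_ident)

lemma beta_of_update:
  fixes I :: "'p::finite set"
  assumes "i \<in> I"
  shows "beta_of I \<eta> z (\<gamma>(i := t)) = beta_of I \<eta> z \<gamma> + (t - \<gamma> i) *\<^sub>R \<eta> i z"
proof -
  have "beta_of I \<eta> z (\<gamma>(i := t)) - beta_of I \<eta> z \<gamma> = (\<Sum>l\<in>I. if l = i then (t - \<gamma> i) *\<^sub>R \<eta> i z else 0)"
    unfolding beta_of_def sum_subtractf[symmetric]
    by (rule sum.cong) (auto simp: scaleR_diff_left)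
  then show ?thesis using assms by (simp add: algebra_simps)
qed

text \<open>Varying \<open>\<gamma> i\<close> alone moves \<open>beta_of\<close> along a straight
  line with direction \<open>\<eta> i z\<close>, to which the chain rule applies the regularized
  Hessian.\<close>

lemma psi_vector_derivative_coordinate:
  fixes I :: "'p::finite set"
  assumes f: "twice_differentiable f" and i: "i \<in> I"
  shows "vector_derivative (\<lambda>t. psi f \<epsilon> I \<eta> z (\<gamma>(i := t))) (at (\<gamma> i)) =
    reg_hessian f \<epsilon> (beta_of I \<eta> z \<gamma>) *v \<eta> i z"
proof (rule vector_derivative_at)
  let ?\<beta> = "beta_of I \<eta> z \<gamma>"
  have "((\<lambda>t. ?\<beta> + (t - \<gamma> i) *\<^sub>R \<eta> i z) has_derivative (\<lambda>h. h *\<^sub>R \<eta> i z)) (at (\<gamma> i))"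
    by (auto intro!: derivative_eq_intros)
  from has_derivative_compose[OF this, of "\<lambda>x. grad f x + \<epsilon> *\<^sub>R x" "\<lambda>v. reg_hessian f \<epsilon> ?\<beta> *v v"]
  have "((\<lambda>t. grad f (?\<beta> + (t - \<gamma> i) *\<^sub>R \<eta> i z) + \<epsilon> *\<^sub>R (?\<beta> + (t - \<gamma> i) *\<^sub>R \<eta> i z)) has_derivative
      (\<lambda>h. reg_hessian f \<epsilon> ?\<beta> *v (h *\<^sub>R \<eta> i z))) (at (\<gamma> i))"
    using reg_gradient_has_derivative[OF f] by simp
  from has_derivative_add[OF this has_derivative_const[of z]]
  show "((\<lambda>t. psi f \<epsilon> I \<eta> z (\<gamma>(i := t))) has_vector_derivative reg_hessian f \<epsilon> ?\<beta> *v \<eta> i z) (at (\<gamma> i))"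
    by (simp add: has_vector_derivative_def psi_def beta_of_update[OF i] matrix_vector_mult_scaleR)
qed

lemma psi_has_derivative:
  fixes I :: "'p::finite set"
  assumes f: "twice_differentiable f"
    and D: "((\<lambda>x. beta_of I \<eta> x \<gamma>) has_derivative D) (at z within M)"
  shows "((\<lambda>x. psi f \<epsilon> I \<eta> x \<gamma>) has_derivative
    (\<lambda>v. reg_hessian f \<epsilon> (beta_of I \<eta> z \<gamma>) *v D v + v)) (at z within M)"
  unfolding psi_def
  by (intro has_derivative_add[OF has_derivative_compose[OF D reg_gradient_has_derivative[OF f]]]
      has_derivative_ident)

section \<open>Pairings and Jacobian formulas over the normal bundle\<close>

theorem theorem2:
  fixes K \<F> W :: "(real^'p) set"
    and F :: "'s measure"
    and loss :: "real^'p \<Rightarrow> 's \<Rightarrow> real"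
    and \<epsilon> :: real
    and A I :: "'p set"
    and V \<eta> :: "'p \<Rightarrow> real^'p \<Rightarrow> real^'p"
  assumes "prob_space F"
    and "AE s in F. twice_differentiable (\<lambda>\<beta>. loss \<beta> s) \<and> convex_on UNIV (\<lambda>\<beta>. loss \<beta> s)"
    and "0 \<le> \<epsilon>"
    and "convex K" and "0 \<in> K"
    and "\<And>\<beta>. bdd_above ((\<lambda>z. \<beta> \<bullet> z) ` K)" and "is_seminorm (support_fun K)"
    and "A \<inter> I = {}" and "A \<union> I = UNIV"
    and "\<F> \<subseteq> K" and "smooth_submanifold (card A) \<F>"
    and "openin (top_of_set \<F>) W"
    and "\<And>j. j \<in> A \<Longrightarrow> smooth_map_on W (V j)"
    and "\<And>i. i \<in> I \<Longrightarrow> smooth_map_on W (\<eta> i)"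
    and "\<And>z. z \<in> W \<Longrightarrow> orthonormal_basis_of A (\<lambda>j. V j z) (tangent_space \<F> z)"
    and "\<And>z. z \<in> W \<Longrightarrow> orthonormal_basis_of I (\<lambda>i. \<eta> i z) (orthogonal_comp (tangent_space \<F> z))"
  shows "AE s in F. \<forall>z\<in>W. \<forall>\<gamma>.
    (let f = (\<lambda>\<beta>. loss \<beta> s);
         \<beta> = beta_of I \<eta> z \<gamma>;
         Q = reg_hessian f \<epsilon> \<beta>;
         g = riem Q;
         V\<psi> = (\<lambda>k. deriv_along \<F> (\<lambda>x. psi f \<epsilon> I \<eta> x \<gamma>) z (V k z));
         D\<psi> = (\<lambda>i. vector_derivative (\<lambda>t. psi f \<epsilon> I \<eta> z (\<gamma>(i := t))) (at (\<gamma> i)));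
         J\<psi> = \<bar>det (\<chi> r c. (if c \<in> A then V\<psi> c else D\<psi> c) $ r)\<bar>;
         P = form_projection g (form_complement g (tangent_space \<F> z));
         C = (\<lambda>j k. shape_op \<F> z (- \<beta>) (V j z) (V k));
         G = (\<lambda>j k. g (V j z) (V k z));
         H = (\<lambda>i l. g (P (\<eta> i z)) (P (\<eta> l z)))
     in \<beta> \<in> normal_cone K z \<longrightarrow> pos_definite Q \<longrightarrow>
        (\<forall>i\<in>I. \<forall>l\<in>I. g (\<eta> i z) (D\<psi> l) = (if i = l then 1 else 0)) \<and>
        (\<forall>j\<in>A. \<forall>i\<in>I. g (V j z) (D\<psi> i) = 0) \<and>
        (\<forall>j\<in>A. \<forall>k\<in>A. g (V j z) (V\<psi> k) =
            shape_op \<F> z (- \<beta>) (V j z) (V k) + g (V j z) (V k z)) \<and>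
        J\<psi> = det Q * det_on A (\<lambda>j k. G j k + C j k) \<and>
        J\<psi> = det_on A (\<lambda>j k. (if j = k then 1 else 0) + (\<Sum>m\<in>A. inv_on A G j m * C m k))
              / det_on I H)"
  using assms(2)
proof (rule AE_mp, intro AE_I2 impI ballI allI)
  fix s z \<gamma>
  assume s: "twice_differentiable (\<lambda>\<beta>. loss \<beta> s) \<and> convex_on UNIV (\<lambda>\<beta>. loss \<beta> s)"
    and z: "z \<in> W"
  define f where "f = (\<lambda>\<beta>. loss \<beta> s)"
  have f: "twice_differentiable f" using s by (simp add: f_def)
  define n where "n x = beta_of I \<eta> x \<gamma>" for x
  define \<beta> where "\<beta> = beta_of I \<eta> z \<gamma>"
  have nz: "n z = \<beta>" by (simp add: n_def \<beta>_def)
  define Q where "Q = reg_hessian f \<epsilon> \<beta>"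
  define V\<psi> where "V\<psi> k = deriv_along \<F> (\<lambda>x. psi f \<epsilon> I \<eta> x \<gamma>) z (V k z)" for k
  define D\<psi> where "D\<psi> i = vector_derivative (\<lambda>t. psi f \<epsilon> I \<eta> z (\<gamma>(i := t))) (at (\<gamma> i))" for i
  define J where "J = \<bar>det (\<chi> r c. (if c \<in> A then V\<psi> c else D\<psi> c) $ r)\<bar>"
  define P where "P = form_projection (riem Q) (form_complement (riem Q) (tangent_space \<F> z))"
  define C where "C j k = shape_op \<F> z (- \<beta>) (V j z) (V k)" for j k
  define G where "G j k = riem Q (V j z) (V k z)" for j k
  define H where "H i l = riem Q (P (\<eta> i z)) (P (\<eta> l z))" for i l
  have notA: "i \<in> I \<longleftrightarrow> i \<notin> A" for i using assms(8,9) by blast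
  have span_V: "span ((\<lambda>j. V j x) ` A) = tangent_space \<F> x" if "x \<in> W" for x
    using assms(15)[OF that] by (simp add: orthonormal_basis_of_def)
  have V_tangent: "V j x \<in> tangent_space \<F> x" if "x \<in> W" "j \<in> A" for j x
    using span_V[OF that(1)] that(2) by (auto intro: span_base)
  have \<eta>_normal: "\<eta> i x \<in> orthogonal_comp (tangent_space \<F> x)" if "x \<in> W" "i \<in> I" for i x
    using assms(16)[OF that(1)] that(2) unfolding orthonormal_basis_of_def
    by (metis imageI span_base)
  have normal: "n x \<in> orthogonal_comp (tangent_space \<F> x)" if "x \<in> W" for x
    unfolding n_def beta_of_def
    by (intro subspace_sum subspace_scale subspace_orthogonal_comp \<eta>_normal that)
  \<comment> \<open>Tangent and normal frame merge into one orthonormal basis indexed by the whole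
    type \<open>'p\<close>, the form in which the determinant lemmas take it.\<close>
  define b where "b c = (if c \<in> A then V c z else \<eta> c z)" for c
  have V\<eta>: "V j z \<bullet> \<eta> i z = 0" if "j \<in> A" "i \<in> I" for i j
    using V_tangent[OF z that(1)] \<eta>_normal[OF z that(2)]
    by (auto simp: orthogonal_comp_def orthogonal_def)
  have b: "b i \<bullet> b j = (if i = j then 1 else 0)" for i j
  proof -
    consider "i \<in> A" "j \<in> A" | "i \<in> A" "j \<in> I" | "i \<in> I" "j \<in> A" | "i \<in> I" "j \<in> I"
      using notA by blast
    then show ?thesis
    proof cases
      case 1
      then show ?thesis
        using assms(15)[OF z] by (simp add: orthonormal_basis_of_def b_def)
    next
      case 2
      then have "j \<notin> A" "i \<noteq> j" using notA by auto
      then show ?thesis using V\<eta>[OF 2] 2 by (simp add: b_def)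
    next
      case 3
      then have "i \<notin> A" "i \<noteq> j" using notA by auto
      then show ?thesis using V\<eta>[OF 3(2,1)] 3 by (simp add: b_def inner_commute)
    next
      case 4
      then have "i \<notin> A" "j \<notin> A" using notA by auto
      then show ?thesis
        using assms(16)[OF z] 4 by (simp add: orthonormal_basis_of_def b_def)
    qed
  qed
  have span_b: "span (b ` A) = tangent_space \<F> z"
    using span_V[OF z] by (simp add: b_def cong: image_cong)

  have "\<exists>D. (\<eta> i has_derivative D) (at z within \<F>)" if "i \<in> I" for i
    using smooth_map_on_has_derivative[OF assms(14)[OF that] assms(12) z] by blast
  then obtain D\<eta> where D\<eta>: "\<And>i. i \<in> I \<Longrightarrow> (\<eta> i has_derivative D\<eta> i) (at z within \<F>)" by metis
  \<comment> \<open>A derivative within \<open>\<F>\<close> of the normal field with its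
    coefficients \<open>\<gamma>\<close> frozen.\<close>
  define D where "D v = (\<Sum>i\<in>I. \<gamma> i *\<^sub>R D\<eta> i v)" for v
  have D: "(n has_derivative D) (at z within \<F>)"
    unfolding n_def[abs_def] beta_of_def D_def[abs_def]
    by (intro has_derivative_sum has_derivative_scaleR_right D\<eta>)
  have V\<psi>: "V\<psi> k = Q *v D (V k z) + V k z" if "k \<in> A" for k
    unfolding V\<psi>_def Q_def \<beta>_def
    by (rule deriv_along_eq[OF psi_has_derivative[OF f] V_tangent[OF z that]])
      (use D in \<open>simp add: n_def[abs_def]\<close>)
  have D\<psi>: "D\<psi> i = Q *v \<eta> i z" if "i \<in> I" for i
    unfolding D\<psi>_def Q_def \<beta>_def by (rule psi_vector_derivative_coordinate[OF f that])
  \<comment> \<open>The Weingarten relation moves the derivative from \<open>V k\<close> to the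
    normal field, and its sign is absorbed by \<open>- \<beta>\<close>. The shape operator
    differentiates along \<open>V j\<close> but \<open>V\<psi> k\<close> along \<open>V k\<close>,
    so symmetry is then used to exchange the two.\<close>
  have C: "C j k = V j z \<bullet> D (V k z)" if j: "j \<in> A" and k: "k \<in> A" for j k
  proof -
    obtain DV where DV: "(V k has_derivative DV) (at z within \<F>)"
      using smooth_map_on_has_derivative[OF assms(13)[OF k] assms(12) z] by blast
    have "n z \<bullet> DV (V j z) = - (D (V j z) \<bullet> V k z)"
      by (rule normal_tangent_derivative[OF assms(12) z D DV _ V_tangent[OF z j]])
        (subst inner_commute, use normal V_tangent k in \<open>auto simp: orthogonal_comp_def orthogonal_def\<close>)
    then have "C j k = V k z \<bullet> D (V j z)"
      by (simp add: C_def shape_op_def deriv_along_eq[OF DV V_tangent[OF z j]] nz inner_commute)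
    also have "\<dots> = V j z \<bullet> D (V k z)"
      by (rule normal_field_derivative_symmetric[OF assms(11,12) z normal D])
        (use V_tangent z j k in auto)
    finally show ?thesis .
  qed
  have Q_sym: "v \<bullet> (Q *v w) = w \<bullet> (Q *v v)" for v w
    unfolding Q_def reg_hessian_mult inner_add_right
    by (simp add: hessian_symmetric[OF f, of v] inner_commute)

  have main: "(\<forall>i\<in>I. \<forall>l\<in>I. riem Q (\<eta> i z) (D\<psi> l) = (if i = l then 1 else 0)) \<and>
        (\<forall>j\<in>A. \<forall>i\<in>I. riem Q (V j z) (D\<psi> i) = 0) \<and>
        (\<forall>j\<in>A. \<forall>k\<in>A. riem Q (V j z) (V\<psi> k) = C j k + riem Q (V j z) (V k z)) \<and>
        J = det Q * det_on A (\<lambda>j k. G j k + C j k) \<and>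
        J = det_on A (\<lambda>j k. (if j = k then 1 else 0) + (\<Sum>m\<in>A. inv_on A G j m * C m k))
              / det_on I H"
    if cone: "\<beta> \<in> normal_cone K z" and Q: "pos_definite Q"
  proof -
    have r1: "riem Q (\<eta> i z) (D\<psi> l) = (if i = l then 1 else 0)" if "i \<in> I" "l \<in> I" for i l
      using b[of i l] that notA by (simp add: D\<psi> riem_mult_right[OF Q] b_def)
    have r2: "riem Q (V j z) (D\<psi> i) = 0" if "j \<in> A" "i \<in> I" for i j
      using that by (simp add: D\<psi> riem_mult_right[OF Q] V\<eta>)
    have r3: "riem Q (V j z) (V\<psi> k) = C j k + riem Q (V j z) (V k z)" if "j \<in> A" "k \<in> A" for j k
      using that by (simp add: V\<psi> C riem_add_right riem_mult_right[OF Q])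
    \<comment> \<open>As \<open>\<F>\<close> lies in \<open>K\<close>, the normal cone condition
      says that the product with \<open>\<beta>\<close> is maximal over the face at
      \<open>z\<close>.\<close>
    have D_nonneg: "0 \<le> v \<bullet> D v" if v: "v \<in> tangent_space \<F> z" for v
      by (rule normal_field_derivative_nonneg[OF assms(11,12) z normal D v])
        (use cone assms(10) in \<open>auto simp: nz normal_cone_def\<close>)
    have linD: "linear D" using D by (rule has_derivative_linear)
    \<comment> \<open>\<open>G + C\<close> is the matrix of \<open>Q^{-1} + D\<close> on the tangent
      space, a positive form plus a nonnegative one.\<close>
    have "0 < det_on A (\<lambda>j k. b j \<bullet> (matrix_inv Q *v b k + D (b k)))"
    proof (rule det_on_bilinear_pos[where f = "\<lambda>v. matrix_inv Q *v v + D v"])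
      show "linear (\<lambda>v. matrix_inv Q *v v + D v)"
        using linD by (intro linear_compose_add matrix_vector_mul_linear)
      show "0 < v \<bullet> (matrix_inv Q *v v + D v)" if "v \<in> span (b ` A)" "v \<noteq> 0" for v
        using riem_pos[OF Q that(2)] D_nonneg[of v] that(1)
        by (simp add: span_b riem_def inner_add_right)
    qed (use b in auto)
    also have "det_on A (\<lambda>j k. b j \<bullet> (matrix_inv Q *v b k + D (b k))) =
        det_on A (\<lambda>j k. G j k + C j k)"
      by (rule det_on_cong) (simp add: b_def G_def C riem_def inner_add_right)
    finally have GC_pos: "0 < det_on A (\<lambda>j k. G j k + C j k)" .
    have "0 < det_on A (\<lambda>j k. b j \<bullet> (matrix_inv Q *v b k))"
      by (rule det_on_bilinear_pos[where f = "\<lambda>v. matrix_inv Q *v v"])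
        (use b riem_pos[OF Q] in \<open>auto simp: riem_def matrix_vector_mul_linear\<close>)
    then have G_pos: "0 < det_on A (\<lambda>j k. riem Q (b j) (b k))" by (simp add: riem_def)
    have G_eq: "det_on A (\<lambda>j k. riem Q (b j) (b k)) = det_on A G"
      by (rule det_on_cong) (simp add: b_def G_def)
    define x where "x c = (if c \<in> A then V\<psi> c else D\<psi> c)" for c
    have x_eq: "det_on A (\<lambda>j k. riem Q (b j) (x k)) = det_on A (\<lambda>j k. G j k + C j k)"
      by (rule det_on_cong) (simp add: b_def x_def r3 G_def)
    have J: "J = det Q * det_on A (\<lambda>j k. G j k + C j k)"
      using jacobian_determinant[OF assms(8,9) b Q, of x] r1 r2 GC_pos
      by (simp add: x_eq) (simp add: J_def x_def b_def notA)
    have "det_on A (\<lambda>j k. riem Q (b j) (b k)) * det_on I (\<lambda>i l. riem Q (P (b i)) (P (b l))) * det Q = 1"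
      using det_gram_complement[OF assms(8,9) b Q Q_sym] G_pos by (simp add: P_def span_b)
    moreover have "det_on I (\<lambda>i l. riem Q (P (b i)) (P (b l))) = det_on I H"
      by (rule det_on_cong) (simp add: b_def H_def notA)
    ultimately have GH: "det_on A G * det_on I H * det Q = 1" by (simp add: G_eq)
    have "det_on I H \<noteq> 0" using GH by auto
    \<comment> \<open>In this form the Gram identity converts the first Jacobian formula into the
      second.\<close>
    then have QG: "det Q * det_on A G = 1 / det_on I H"
      using GH by (simp add: field_simps)
    let ?E = "det_on A (\<lambda>j k. (if j = k then 1 else 0) + (\<Sum>m\<in>A. inv_on A G j m * C m k))"
    have "det_on A (\<lambda>j k. G j k + C j k) = det_on A G * ?E"
      by (rule det_on_add) (use G_pos G_eq in simp)
    then have "J = det Q * det_on A G * ?E" unfolding J by simp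
    also have "\<dots> = ?E / det_on I H" unfolding QG by simp
    finally have "J = ?E / det_on I H" .
    then show ?thesis using r1 r2 r3 J by blast
  qed
  show "let f = (\<lambda>\<beta>. loss \<beta> s);
         \<beta> = beta_of I \<eta> z \<gamma>;
         Q = reg_hessian f \<epsilon> \<beta>;
         g = riem Q;
         V\<psi> = (\<lambda>k. deriv_along \<F> (\<lambda>x. psi f \<epsilon> I \<eta> x \<gamma>) z (V k z));
         D\<psi> = (\<lambda>i. vector_derivative (\<lambda>t. psi f \<epsilon> I \<eta> z (\<gamma>(i := t))) (at (\<gamma> i)));
         J\<psi> = \<bar>det (\<chi> r c. (if c \<in> A then V\<psi> c else D\<psi> c) $ r)\<bar>;
         P = form_projection g (form_complement g (tangent_space \<F> z));
         C = (\<lambda>j k. shape_op \<F> z (- \<beta>) (V j z) (V k));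
         G = (\<lambda>j k. g (V j z) (V k z));
         H = (\<lambda>i l. g (P (\<eta> i z)) (P (\<eta> l z)))
     in \<beta> \<in> normal_cone K z \<longrightarrow> pos_definite Q \<longrightarrow>
        (\<forall>i\<in>I. \<forall>l\<in>I. g (\<eta> i z) (D\<psi> l) = (if i = l then 1 else 0)) \<and>
        (\<forall>j\<in>A. \<forall>i\<in>I. g (V j z) (D\<psi> i) = 0) \<and>
        (\<forall>j\<in>A. \<forall>k\<in>A. g (V j z) (V\<psi> k) =
            shape_op \<F> z (- \<beta>) (V j z) (V k) + g (V j z) (V k z)) \<and>
        J\<psi> = det Q * det_on A (\<lambda>j k. G j k + C j k) \<and>
        J\<psi> = det_on A (\<lambda>j k. (if j = k then 1 else 0) + (\<Sum>m\<in>A. inv_on A G j m * C m k))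
              / det_on I H"
    using main
    unfolding Let_def J_def V\<psi>_def[abs_def] D\<psi>_def[abs_def] H_def[abs_def] G_def[abs_def] C_def[abs_def]
      P_def Q_def \<beta>_def f_def
    by blast
qed

end
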